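(* For any closed point $q\in T_\varphi$, the Jacobian matrix $J(q)$ of $T_\varphi$ at $q$ contains $\theta E_d$ as a submatrix, where $\theta\in K^*$ and $E_d$ is the identity matrix of rank $d$. In particular, $T_\varphi$ is smooth.
   Context: Let $K$ be an algebraically closed field of characteristic zero, $d\ge 1$ an integer, $V=K[x,y]_1$ the space of linear forms in $x,y$, and $\lambda=(1^{e_1}2^{e_2}\cdots d^{e_d})$ a partition of $d$, where $e_r\ge 0$ is the number of parts equal to $r$ (so $\sum_{r=1}^d r e_r=d$). A closed point $(b_0:\cdots:b_k)$ of $\mathbb{P}(\mathrm{Sym}^kV)\cong\mathbb{P}^k_K$ is identified with the binary form $\sum_{j=0}^k b_jx^{k-j}y^j$ up to scalars in $K^*$. Put $Y_\lambda=\prod_{r=1}^d\mathbb{P}(\mathrm{Sym}^{e_r}V)$ and $T=\mathbb{P}(\mathrm{Sym}^dV)\times Y_\lambda$. Let $e_0=d$ and $\Lambda=\{0,\dots,e_0\}\times\{0,\dots,e_1\}\times\cdots\times\{0,\dots,e_d\}$. For $\underline\alpha=(\alpha_0,\dots,\alpha_d)\in\Lambda$ let $U_{\underline\alpha}=U_{\alpha_0}\times\cdots\times U_{\alpha_d}\subseteq T$, where $U_{\alpha_r}$ is the $\alpha_r$-th standard affine chart (the $\alpha_r$-th homogeneous coordinate is nonzero and normalized to $1$) of $\mathbb{P}(\mathrm{Sym}^{e_r}V)$, for $r=0,\dots,d$. The $U_{\underline\alpha}$ form an affine open cover of $T$. Let $z_j$ ($0\le j\le d$, $j\ne\alpha_0$)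 be the affine coordinates on $U_{\alpha_0}\subset\mathbb{P}(\mathrm{Sym}^dV)$, put $z_{\alpha_0}=1$, and let $w_{r,t}$ ($1\le r\le d$, $0\le t\le e_r$, $t\neq\alpha_r$) be the affine coordinates on $U_{\alpha_r}\subset\mathbb{P}(\mathrm{Sym}^{e_r}V)$; thus $\mathcal{O}(U_{\underline\alpha})$ is the polynomial ring over $K$ in all these coordinates. Let $\Theta_0,\dots,\Theta_d$ be the polynomials in indeterminates $W_{r,t}$ ($1\le r\le d$, $0\le t\le e_r$) defined by the identity $$\prod_{r=1}^d\Big(\sum_{t=0}^{e_r}W_{r,t}x^{e_r-t}y^t\Big)^r=\sum_{j=0}^d\Theta_j\,x^{d-j}y^j .$$ Let $\theta_{j}=\theta_{j,\underline\alpha}\in\mathcal{O}(U_{\underline\alpha})$ be obtained from $\Theta_j$ by substituting $W_{r,\alpha_r}\mapsto 1$ and $W_{r,t}\mapsto w_{r,t}$ for $t\ne\alpha_r$. Define the $2\times(d+1)$ matrix over $\mathcal{O}(U_{\underline\alpha})$ $$(\varphi_{\underline\alpha})=\begin{pmatrix}\theta_{0}&\cdots&\theta_{\alpha_0-1}&\theta_{\alpha_0}&\theta_{\alpha_0+1}&\cdots&\theta_{d}\\ z_{0}&\cdots&z_{\alpha_0-1}&1&z_{\alpha_0+1}&\cdots&z_{d}\end{pmatrix}.$$ $T_\varphi$ denotes the closed subscheme of $T$ such that, for every $\underline\alpha\in\Lambda$, the ideal of $T_\varphi\cap U_{\underline\alpha}$ in $\mathcal{O}(U_{\underline\alpha})$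 is generated by the $2\times2$-minors of $(\varphi_{\underline\alpha})$ (these local ideals, the zeroth Fitting ideals of the cokernels of the $\varphi_{\underline\alpha}$, agree on overlaps). Jacobian matrix: for a closed point $q\in T_\varphi\cap U_{\underline\alpha}$, the ideal of $T_\varphi\cap U_{\underline\alpha}$ is generated by the $d$ elements $\theta_{\alpha_0}z_j-\theta_j$, $j\in\{0,\dots,d\}\setminus\{\alpha_0\}$, and $J(q)$ is the matrix of the values at $q$ of the partial derivatives of these generators with respect to all the coordinates $z_l$ ($l\neq\alpha_0$) and $w_{r,t}$ ($t\ne\alpha_r$) of $U_{\underline\alpha}$. *)

theory Defs
  imports
    "HOL-Library.Poly_Mapping"
    "HOL-Computational_Algebra.Polynomial"
    "HOL-Algebra.QuotRing"
    "HOL-Algebra.Algebraic_Closure_Type"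
    "Jordan_Normal_Form.Determinant"
    "Jordan_Normal_Form.DL_Submatrix"
begin

type_synonym ('v, 'a) mpoly = "('v \<Rightarrow>\<^sub>0 nat) \<Rightarrow>\<^sub>0 'a"

definition Const :: "'a::comm_ring_1 \<Rightarrow> ('v, 'a) mpoly" where
  "Const c = Poly_Mapping.single 0 c"

definition Var :: "'v \<Rightarrow> ('v, 'a::comm_ring_1) mpoly" where
  "Var v = Poly_Mapping.single (Poly_Mapping.single v 1) 1"

definition mp_eval ::
  "('a::comm_ring_1 \<Rightarrow> 'b::comm_ring_1) \<Rightarrow> ('v \<Rightarrow> 'b) \<Rightarrow> ('v, 'a) mpoly \<Rightarrow> 'b" where
  "mp_eval f \<sigma> p =
     (\<Sum>m\<in>Poly_Mapping.keys p. f (Poly_Mapping.lookup p m) *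
        (\<Prod>v\<in>Poly_Mapping.keys m. \<sigma> v ^ Poly_Mapping.lookup m v))"

definition mp_deriv :: "'v \<Rightarrow> ('v, 'a::comm_ring_1) mpoly \<Rightarrow> ('v, 'a) mpoly" where
  "mp_deriv v p =
     (\<Sum>m\<in>Poly_Mapping.keys p.
        Poly_Mapping.single (m - Poly_Mapping.single v 1)
          (of_nat (Poly_Mapping.lookup m v) * Poly_Mapping.lookup p m))"

definition mp_ring :: "'v set \<Rightarrow> ('v, 'a::comm_ring_1) mpoly ring" where
  "mp_ring V =
     ring_of_type_algebra \<lparr>carrier := {p. \<forall>m\<in>Poly_Mapping.keys p. Poly_Mapping.keys m \<subseteq> V}\<rparr>"

text \<open>
  An algebra over the field \<open>'a\<close> is a ring \<open>A\<close> with a structure map \<open>s\<close> from \<open>'a\<close> to \<open>A\<close>.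
  An algebra is smooth if it is finitely presented and formally smooth (infinitesimal lifting
  along ideals of square zero, as in EGA IV 17).
  The test algebras \<open>C\<close> have their carriers in the type \<open>'c\<close>; as one cannot quantify over types
  inside a formula, this type is an explicit parameter, to be left arbitrary in theorems.
\<close>

definition finitely_presented ::
  "('a::field \<Rightarrow> 'b) \<Rightarrow> ('b, 'm) ring_scheme \<Rightarrow> bool" where
  "finitely_presented s A \<longleftrightarrow>
     (\<exists>n F \<pi>. let P = (mp_ring {..<n} :: (nat, 'a) mpoly ring) in
        finite F \<and> F \<subseteq> carrier P \<and> \<pi> \<in> Ring.ring_hom P A \<and> \<pi> ` carrier P = carrier A \<and>
        a_kernel P A \<pi> = Idl\<^bsub>P\<^esub> F \<and> (\<forall>c. \<pi> (Const c) = s c))"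

definition formally_smooth ::
  "'c itself \<Rightarrow> ('a::field \<Rightarrow> 'b) \<Rightarrow> ('b, 'm) ring_scheme \<Rightarrow> bool" where
  "formally_smooth (_ :: 'c itself) s A \<longleftrightarrow>
     (\<forall>(C :: 'c ring) N u g.
        cring C \<and> ideal N C \<and> (\<forall>x\<in>N. \<forall>y\<in>N. x \<otimes>\<^bsub>C\<^esub> y = \<zero>\<^bsub>C\<^esub>) \<and>
        u \<in> Ring.ring_hom ring_of_type_algebra C \<and>
        g \<in> Ring.ring_hom A (C Quot N) \<and> (\<forall>c. g (s c) = N +>\<^bsub>C\<^esub> u c) \<longrightarrow>
        (\<exists>h\<in>Ring.ring_hom A C. (\<forall>c. h (s c) = u c) \<and> (\<forall>a\<in>carrier A. N +>\<^bsub>C\<^esub> h a = g a)))"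

definition smooth_algebra ::
  "'c itself \<Rightarrow> ('a::field \<Rightarrow> 'b) \<Rightarrow> ('b, 'm) ring_scheme \<Rightarrow> bool" where
  "smooth_algebra T s A \<longleftrightarrow>
     cring A \<and> s \<in> Ring.ring_hom ring_of_type_algebra A \<and>
     finitely_presented s A \<and> formally_smooth T s A"

text \<open>
  Throughout, \<open>e r\<close> is the number of parts equal to \<open>r\<close> for \<open>1 \<le> r \<le> d\<close>, and \<open>e 0 = d\<close>, so that
  \<open>T\<close> is the product of the projective spaces of dimensions \<open>e 0, \<dots>, e d\<close>.
  A closed point of \<open>T\<close> is given by homogeneous coordinates \<open>b r t\<close> for \<open>r \<le> d\<close> and \<open>t \<le> e r\<close>;
  everything below depends on \<open>b r\<close> only up to a nonzero scalar.
\<close>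

definition T_points :: "nat \<Rightarrow> (nat \<Rightarrow> nat) \<Rightarrow> (nat \<Rightarrow> nat \<Rightarrow> 'a::field) set" where
  "T_points d e = {b. \<forall>r\<le>d. \<exists>t\<le>e r. b r t \<noteq> 0}"

definition chart_indices :: "nat \<Rightarrow> (nat \<Rightarrow> nat) \<Rightarrow> (nat \<Rightarrow> nat) set" where
  "chart_indices d e = (\<Pi>\<^sub>E r\<in>{0..d}. {0..e r})"

definition U_points :: "nat \<Rightarrow> (nat \<Rightarrow> nat) \<Rightarrow> (nat \<Rightarrow> nat) \<Rightarrow> (nat \<Rightarrow> nat \<Rightarrow> 'a::field) set" where
  "U_points d e \<alpha> = {b \<in> T_points d e. \<forall>r\<le>d. b r (\<alpha> r) \<noteq> 0}"

definition affine_coords :: "(nat \<Rightarrow> nat) \<Rightarrow> (nat \<Rightarrow> nat \<Rightarrow> 'a::field) \<Rightarrow> nat \<times> nat \<Rightarrow> 'a" where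
  "affine_coords \<alpha> b = (\<lambda>(r, t). b r t / b r (\<alpha> r))"

text \<open>
  The variable \<open>(0, j)\<close> is the coordinate \<open>z\<^sub>j\<close>, and \<open>(r, t)\<close> with \<open>r \<ge> 1\<close> is \<open>w\<^sub>r\<^sub>,\<^sub>t\<close>.
  The list starts with the \<open>z\<^sub>j\<close>.
\<close>

definition chart_vars :: "nat \<Rightarrow> (nat \<Rightarrow> nat) \<Rightarrow> (nat \<Rightarrow> nat) \<Rightarrow> (nat \<times> nat) list" where
  "chart_vars d e \<alpha> = [(r, t). r \<leftarrow> [0..<Suc d], t \<leftarrow> [0..<Suc (e r)], t \<noteq> \<alpha> r]"

definition chart_ring ::
  "nat \<Rightarrow> (nat \<Rightarrow> nat) \<Rightarrow> (nat \<Rightarrow> nat) \<Rightarrow> (nat \<times> nat, 'a::field) mpoly ring" where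
  "chart_ring d e \<alpha> = mp_ring (set (chart_vars d e \<alpha>))"

definition normalized_var ::
  "(nat \<Rightarrow> nat) \<Rightarrow> nat \<times> nat \<Rightarrow> (nat \<times> nat, 'a::field) mpoly" where
  "normalized_var \<alpha> = (\<lambda>(r, t). if t = \<alpha> r then 1 else Var (r, t))"

text \<open>
  A closed subscheme of \<open>T\<close> is given by its ideals \<open>I \<alpha>\<close> in the rings of the charts.
  Smoothness over the base field is local on the source, hence checked on the charts.
\<close>

definition smooth_subscheme ::
  "'c itself \<Rightarrow> nat \<Rightarrow> (nat \<Rightarrow> nat) \<Rightarrow>
    ((nat \<Rightarrow> nat) \<Rightarrow> (nat \<times> nat, 'a::field) mpoly set) \<Rightarrow> bool" where
  "smooth_subscheme T d e I \<longleftrightarrow>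
     (\<forall>\<alpha>\<in>chart_indices d e.
        smooth_algebra T (\<lambda>c. I \<alpha> +>\<^bsub>chart_ring d e \<alpha>\<^esub> Const c) (chart_ring d e \<alpha> Quot I \<alpha>))"

definition subscheme_points ::
  "nat \<Rightarrow> (nat \<Rightarrow> nat) \<Rightarrow> ((nat \<Rightarrow> nat) \<Rightarrow> (nat \<times> nat, 'a::field) mpoly set) \<Rightarrow>
    (nat \<Rightarrow> nat \<Rightarrow> 'a) set" where
  "subscheme_points d e I =
     (\<Union>\<alpha>\<in>chart_indices d e.
        {b \<in> U_points d e \<alpha>. \<forall>f\<in>I \<alpha>. mp_eval (\<lambda>c. c) (affine_coords \<alpha> b) f = 0})"

text \<open>Binary forms are polynomials in \<open>y\<close> (inner variable) and \<open>x\<close> (outer variable).\<close>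

definition binary_form :: "nat \<Rightarrow> (nat \<Rightarrow> 'b::comm_ring_1) \<Rightarrow> 'b poly poly" where
  "binary_form k b = (\<Sum>t\<le>k. Polynomial.monom (Polynomial.monom (b t) t) (k - t))"

definition Theta :: "nat \<Rightarrow> (nat \<Rightarrow> nat) \<Rightarrow> nat \<Rightarrow> (nat \<times> nat, 'a::field) mpoly" where
  "Theta d e j =
     Polynomial.coeff (Polynomial.coeff
       (\<Prod>r=1..d. binary_form (e r) (\<lambda>t. Var (r, t)) ^ r) (d - j)) j"

definition theta ::
  "nat \<Rightarrow> (nat \<Rightarrow> nat) \<Rightarrow> (nat \<Rightarrow> nat) \<Rightarrow> nat \<Rightarrow> (nat \<times> nat, 'a::field) mpoly" where
  "theta d e \<alpha> j = mp_eval Const (normalized_var \<alpha>) (Theta d e j)"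

definition phi_mat ::
  "nat \<Rightarrow> (nat \<Rightarrow> nat) \<Rightarrow> (nat \<Rightarrow> nat) \<Rightarrow> (nat \<times> nat, 'a::field) mpoly mat" where
  "phi_mat d e \<alpha> =
     mat 2 (d + 1) (\<lambda>(i, j). if i = 0 then theta d e \<alpha> j else normalized_var \<alpha> (0, j))"

definition minors :: "nat \<Rightarrow> 'b::comm_ring_1 mat \<Rightarrow> 'b set" where
  "minors k A = {det (submatrix A I J) | I J.
     I \<subseteq> {..<dim_row A} \<and> J \<subseteq> {..<dim_col A} \<and> card I = k \<and> card J = k}"

definition T_phi ::
  "nat \<Rightarrow> (nat \<Rightarrow> nat) \<Rightarrow> (nat \<Rightarrow> nat) \<Rightarrow> (nat \<times> nat, 'a::field) mpoly set" where
  "T_phi d e \<alpha> = Idl\<^bsub>chart_ring d e \<alpha>\<^esub> (minors 2 (phi_mat d e \<alpha>))"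

text \<open>
  \<open>T_phi d e \<alpha>\<close> is the ideal of the subscheme in the chart \<open>\<alpha>\<close>; these ideals agree on overlaps.
  It is also generated by the list \<open>generators\<close>, on which the Jacobian matrix is based.
  The rows of the Jacobian matrix in the chart \<open>\<alpha>\<close> belong to the generators
  \<open>theta (\<alpha> 0) * z\<^sub>j - theta j\<close> with \<open>j \<noteq> \<alpha> 0\<close>, its columns to the coordinates in \<open>chart_vars\<close>.
\<close>

definition generators ::
  "nat \<Rightarrow> (nat \<Rightarrow> nat) \<Rightarrow> (nat \<Rightarrow> nat) \<Rightarrow> (nat \<times> nat, 'a::field) mpoly list" where
  "generators d e \<alpha> =
     [theta d e \<alpha> (\<alpha> 0) * Var (0, j) - theta d e \<alpha> j. j \<leftarrow> [0..<Suc d], j \<noteq> \<alpha> 0]"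

definition jacobian ::
  "nat \<Rightarrow> (nat \<Rightarrow> nat) \<Rightarrow> (nat \<Rightarrow> nat) \<Rightarrow> (nat \<Rightarrow> nat \<Rightarrow> 'a::field) \<Rightarrow> 'a mat" where
  "jacobian d e \<alpha> b =
     mat (length (generators d e \<alpha> :: (nat \<times> nat, 'a) mpoly list)) (length (chart_vars d e \<alpha>))
       (\<lambda>(i, k). mp_eval (\<lambda>c. c) (affine_coords \<alpha> b)
          (mp_deriv (chart_vars d e \<alpha> ! k) (generators d e \<alpha> ! i)))"

end

theory Submission
  imports Defs
begin

text \<open>
  On the chart \<open>\<alpha>\<close>, let \<open>f\<^sub>r\<close> be the universal form of degree \<open>e r\<close>, with its coefficient number
  \<open>\<alpha> r\<close> normalized to 1, and let \<open>F\<close> be the product of the \<open>f\<^sub>r\<^sup>r\<close>, so that the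
  \<open>\<theta>\<^sub>j\<close> are the coefficients of \<open>F\<close>.  The minors say that the vectors \<open>(\<theta>\<^sub>j)\<close> and \<open>(z\<^sub>j)\<close>
  are proportional; as the entry \<open>z\<close> number \<open>\<alpha> 0\<close> is 1, this means \<open>\<theta>\<^sub>j = \<theta> z\<^sub>j\<close> for all \<open>j\<close>,
  where \<open>\<theta>\<close> is the \<open>\<theta>\<^sub>j\<close> with \<open>j = \<alpha> 0\<close>.
  Everything rests on the fact that \<open>\<theta>\<close> is invertible on \<open>T_phi\<close>: where \<open>\<theta>\<close> vanishes, so do
  all \<open>\<theta>\<^sub>j\<close>, hence \<open>F = 0\<close>, and this is impossible for a product of forms each of which has a
  coefficient equal to 1.  At a closed point the last step holds because polynomials over a field
  have no zero divisors (\<open>theta_nonzero_at_point\<close>).  In the coordinate ring it is McCoy's theorem,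
  applied modulo the ideal generated by \<open>T_phi\<close> and \<open>\<theta>\<close> (\<open>regular_modulo_ideal_if_coeff_one\<close>,
  \<open>theta_unit_modulo_T_phi\<close>).

  The Jacobian matrix.  The \<open>\<theta>\<^sub>j\<close> involve only the coordinates \<open>w\<close>, so the derivative of
  \<open>\<theta> z\<^sub>j - \<theta>\<^sub>j\<close> by \<open>z\<^sub>l\<close> is \<open>\<theta>\<close> for \<open>l = j\<close> and 0 otherwise: the columns of the \<open>z\<^sub>l\<close> form the
  matrix \<open>\<theta>\<close> times the identity, and \<open>\<theta>\<close> has a nonzero value at each point of \<open>T_phi\<close>.

  Smoothness.  By the same equations \<open>T_phi\<close> is, in the chart, the graph of the morphism
  \<open>z\<^sub>j = \<theta>\<^sub>j / \<theta>\<close> on the open set of the affine space of the \<open>w\<close> on which \<open>\<theta>\<close> is invertible.  This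
  description gives the infinitesimal lifting directly (\<open>formally_smooth_T_phi\<close>): lift the
  values of the \<open>w\<close> arbitrarily; the value of \<open>\<theta>\<close> is then a unit, because it is a unit modulo an
  ideal of square zero; and \<open>z\<^sub>j\<close> has to be sent to \<open>\<theta>\<^sub>j / \<theta>\<close>.

  The forms are handled through their dehomogenizations at \<open>x = 1\<close>, which are polynomials in one
  variable with the same coefficients.
\<close>

section \<open>Polynomials in many variables\<close>

lemma ring_of_type_algebra_simps [simp]:
  "carrier ring_of_type_algebra = UNIV"
  "x \<otimes>\<^bsub>ring_of_type_algebra\<^esub> y = x * y"
  "x \<oplus>\<^bsub>ring_of_type_algebra\<^esub> y = x + y"
  "\<one>\<^bsub>ring_of_type_algebra\<^esub> = 1"
  "\<zero>\<^bsub>ring_of_type_algebra\<^esub> = 0"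
  by (simp_all add: ring_of_type_algebra_def)

lemma mp_ring_simps [simp]:
  "x \<otimes>\<^bsub>mp_ring V\<^esub> y = x * y"
  "x \<oplus>\<^bsub>mp_ring V\<^esub> y = x + y"
  "\<one>\<^bsub>mp_ring V\<^esub> = 1"
  "\<zero>\<^bsub>mp_ring V\<^esub> = 0"
  by (simp_all add: mp_ring_def)

lemma mem_mp_ring:
  "p \<in> carrier (mp_ring V) \<longleftrightarrow> (\<forall>m\<in>Poly_Mapping.keys p. Poly_Mapping.keys m \<subseteq> V)"
  by (simp add: mp_ring_def)

lemma mp_ring_mono: "V \<subseteq> W \<Longrightarrow> carrier (mp_ring V) \<subseteq> carrier (mp_ring W)"
  by (force simp: mem_mp_ring)

lemma mp_ring_closed [intro, simp]:
  fixes p q :: "('v, 'a::comm_ring_1) mpoly"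
  shows "Const c \<in> carrier (mp_ring V)"
    and "v \<in> V \<Longrightarrow> Var v \<in> carrier (mp_ring V)"
    and "0 \<in> carrier (mp_ring V)"
    and "1 \<in> carrier (mp_ring V)"
    and "p \<in> carrier (mp_ring V) \<Longrightarrow> q \<in> carrier (mp_ring V) \<Longrightarrow> p + q \<in> carrier (mp_ring V)"
    and "p \<in> carrier (mp_ring V) \<Longrightarrow> q \<in> carrier (mp_ring V) \<Longrightarrow> p * q \<in> carrier (mp_ring V)"
    and "p \<in> carrier (mp_ring V) \<Longrightarrow> - p \<in> carrier (mp_ring V)"
    and "p \<in> carrier (mp_ring V) \<Longrightarrow> q \<in> carrier (mp_ring V) \<Longrightarrow> p - q \<in> carrier (mp_ring V)"
proof -
  show "Const c \<in> carrier (mp_ring V)" "0 \<in> carrier (mp_ring V)" "1 \<in> carrier (mp_ring V)"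
    by (auto simp: mem_mp_ring Const_def split: if_splits)
  show "v \<in> V \<Longrightarrow> Var v \<in> carrier (mp_ring V)"
    by (auto simp: mem_mp_ring Var_def split: if_splits)
  show add: "p + q \<in> carrier (mp_ring V)"
    if "p \<in> carrier (mp_ring V)" "q \<in> carrier (mp_ring V)" for p q :: "('v, 'a) mpoly"
    using that Poly_Mapping.keys_add[of p q] unfolding mem_mp_ring by blast
  show neg: "- p \<in> carrier (mp_ring V)"
    if "p \<in> carrier (mp_ring V)" for p :: "('v, 'a) mpoly"
    using that by (simp add: mem_mp_ring in_keys_iff)
  show "p - q \<in> carrier (mp_ring V)"
    if "p \<in> carrier (mp_ring V)" "q \<in> carrier (mp_ring V)" for p q :: "('v, 'a) mpoly"
    using add[OF that(1) neg[OF that(2)]] by simp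
  show "p * q \<in> carrier (mp_ring V)"
    if "p \<in> carrier (mp_ring V)" "q \<in> carrier (mp_ring V)" for p q :: "('v, 'a) mpoly"
    unfolding mem_mp_ring
  proof
    fix m assume "m \<in> Poly_Mapping.keys (p * q)"
    then obtain a b where ab: "m = a + b" "a \<in> Poly_Mapping.keys p" "b \<in> Poly_Mapping.keys q"
      using Poly_Mapping.keys_mult[of p q] by blast
    then show "Poly_Mapping.keys m \<subseteq> V"
      using that Poly_Mapping.keys_add[of a b] unfolding mem_mp_ring by blast
  qed
qed

lemma mp_ring_cring: "cring (mp_ring V :: ('v, 'a::comm_ring_1) mpoly ring)"
proof (intro cringI abelian_groupI comm_monoidI)
  fix p :: "('v, 'a) mpoly"
  assume "p \<in> carrier (mp_ring V)"
  then show "\<exists>q\<in>carrier (mp_ring V). q \<oplus>\<^bsub>mp_ring V\<^esub> p = \<zero>\<^bsub>mp_ring V\<^esub>"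
    by (intro bexI[of _ "- p"]) auto
qed (auto simp: algebra_simps)

lemma Var_power: "Var v ^ n = Poly_Mapping.single (Poly_Mapping.single v n) 1"
  by (induction n) (simp_all add: Var_def mult_single single_add[symmetric])

text \<open>
  The polynomials in the variables \<open>V\<close> form the smallest subring that contains the constants and
  these variables.  Statements about them are proved by this induction, which avoids monomials.
\<close>

lemma mp_ring_induct [consumes 1, case_names Const Var add mult]:
  fixes p :: "('v, 'a::comm_ring_1) mpoly"
  assumes p: "p \<in> carrier (mp_ring V)"
    and Const: "\<And>c. P (Const c)"
    and Var: "\<And>v. v \<in> V \<Longrightarrow> P (Var v)"
    and add: "\<And>p q. p \<in> carrier (mp_ring V) \<Longrightarrow> q \<in> carrier (mp_ring V) \<Longrightarrow> P p \<Longrightarrow> P q \<Longrightarrow> P (p + q)"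
    and mult: "\<And>p q. p \<in> carrier (mp_ring V) \<Longrightarrow> q \<in> carrier (mp_ring V) \<Longrightarrow> P p \<Longrightarrow> P q \<Longrightarrow> P (p * q)"
  shows "P p"
proof -
  let ?Q = "\<lambda>p. p \<in> carrier (mp_ring V) \<and> P p"
  have one: "?Q 1"
    using Const[of 1] by (simp add: Const_def)
  have pow: "?Q (Var v ^ n)" if "v \<in> V" for v n
    by (induction n) (use one that in \<open>auto intro: mult Var\<close>)
  have monomial: "?Q (Poly_Mapping.single m 1)" if "Poly_Mapping.keys m \<subseteq> V" for m
    using that
  proof (induction m rule: update_induct)
    case const
    then show ?case using one by simp
  next
    case (update m v n)
    have "Poly_Mapping.update v n m = m + Poly_Mapping.single v n"
      using update.hyps
      by (intro poly_mapping_eqI) (auto simp: lookup_update lookup_add lookup_single in_keys_iff)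
    then have "Poly_Mapping.single (Poly_Mapping.update v n m) 1
      = (Poly_Mapping.single m 1 * Var v ^ n :: ('v, 'a) mpoly)"
      by (simp add: Var_power mult_single)
    moreover have "v \<in> V" "Poly_Mapping.keys m \<subseteq> V"
      using update by (auto simp: keys_update split: if_splits)
    ultimately show ?case
      using update.IH pow[of v n] by (auto intro: mult)
  qed
  have "?Q p" using p
  proof (induction p rule: update_induct)
    case const
    then show ?case using Const[of 0] by (simp add: Const_def)
  next
    case (update p m c)
    have eq: "Poly_Mapping.update m c p = p + Const c * Poly_Mapping.single m 1"
      using update.hyps
      by (intro poly_mapping_eqI)
         (auto simp: lookup_update lookup_add lookup_single in_keys_iff Const_def mult_single)
    have "p \<in> carrier (mp_ring V)" "Poly_Mapping.keys m \<subseteq> V"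
      using update by (auto simp: mem_mp_ring keys_update split: if_splits)
    then show ?case
      unfolding eq using update.IH Const[of c] monomial[of m] by (auto intro: mult add)
  qed
  then show ?thesis ..
qed

section \<open>Evaluation of polynomials in a ring\<close>

text \<open>
  The test algebras for smoothness are rings with a carrier, so the universal property of the
  polynomial ring is needed with such rings as targets.  The values \<open>\<sigma>\<close> are prescribed for all
  variables of the type, whence the evaluation is defined on all polynomials at once.
\<close>

locale mpoly_evaluation = cring C for C (structure) +
  fixes u :: "'k::comm_ring_1 \<Rightarrow> _" and \<sigma> :: "'v \<Rightarrow> _"
  assumes scalar_hom: "u \<in> Ring.ring_hom ring_of_type_algebra C"
    and point_closed [simp, intro]: "\<sigma> v \<in> carrier C"
begin

definition monomial_value :: "('v \<Rightarrow>\<^sub>0 nat) \<Rightarrow> _" where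
  "monomial_value m = (\<Otimes>v\<in>Poly_Mapping.keys m. \<sigma> v [^] Poly_Mapping.lookup m v)"

definition evaluate :: "('v, 'k) mpoly \<Rightarrow> _" where
  "evaluate p = (\<Oplus>m\<in>Poly_Mapping.keys p. u (Poly_Mapping.lookup p m) \<otimes> monomial_value m)"

lemma scalar_closed [simp, intro]: "u c \<in> carrier C"
  using ring_hom_closed[OF scalar_hom] by simp

lemma scalar_simps [simp]:
  "u (a + b) = u a \<oplus> u b" "u (a * b) = u a \<otimes> u b" "u 1 = \<one>" "u 0 = \<zero>"
proof -
  show add: "u (a + b) = u a \<oplus> u b" for a b
    using ring_hom_add[OF scalar_hom, of a b] by simp
  show "u (a * b) = u a \<otimes> u b" "u 1 = \<one>"
    using ring_hom_mult[OF scalar_hom, of a b] ring_hom_one[OF scalar_hom] by simp_all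
  have "u 0 \<oplus> u 0 = u 0"
    using add[of 0 0] by simp
  then show "u 0 = \<zero>"
    using scalar_closed[of 0] add.l_cancel_one by blast
qed

lemma monomial_value_closed [simp, intro]: "monomial_value m \<in> carrier C"
  unfolding monomial_value_def by (rule finprod_closed) auto

lemma monomial_value_superset:
  assumes "finite W" "Poly_Mapping.keys m \<subseteq> W"
  shows "monomial_value m = (\<Otimes>v\<in>W. \<sigma> v [^] Poly_Mapping.lookup m v)"
  unfolding monomial_value_def
  by (rule finprod_mono_neutral_cong_left[OF assms])
     (auto simp: in_keys_iff)

lemma monomial_value_add: "monomial_value (m + n) = monomial_value m \<otimes> monomial_value n"
proof -
  define W where "W = Poly_Mapping.keys m \<union> Poly_Mapping.keys n"
  have W: "finite W" "Poly_Mapping.keys m \<subseteq> W" "Poly_Mapping.keys n \<subseteq> W" "Poly_Mapping.keys (m + n) \<subseteq> W"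
    using Poly_Mapping.keys_add[of m n] by (auto simp: W_def)
  have "(\<Otimes>v\<in>W. \<sigma> v [^] Poly_Mapping.lookup (m + n) v) =
    (\<Otimes>v\<in>W. \<sigma> v [^] Poly_Mapping.lookup m v \<otimes> \<sigma> v [^] Poly_Mapping.lookup n v)"
    by (rule finprod_cong') (auto simp: lookup_add nat_pow_mult)
  also have "\<dots> = (\<Otimes>v\<in>W. \<sigma> v [^] Poly_Mapping.lookup m v) \<otimes> (\<Otimes>v\<in>W. \<sigma> v [^] Poly_Mapping.lookup n v)"
    by (rule finprod_multf) auto
  finally show ?thesis
    by (simp only: monomial_value_superset[OF W(1) W(2)] monomial_value_superset[OF W(1) W(3)]
        monomial_value_superset[OF W(1) W(4)])
qed

lemma evaluate_closed [simp, intro]: "evaluate p \<in> carrier C"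
  unfolding evaluate_def by (rule finsum_closed) auto

lemma evaluate_superset:
  assumes "finite M" "Poly_Mapping.keys p \<subseteq> M"
  shows "evaluate p = (\<Oplus>m\<in>M. u (Poly_Mapping.lookup p m) \<otimes> monomial_value m)"
  unfolding evaluate_def
  by (rule add.finprod_mono_neutral_cong_left[OF assms])
     (auto simp: in_keys_iff)

lemma evaluate_add: "evaluate (p + q) = evaluate p \<oplus> evaluate q"
proof -
  define M where "M = Poly_Mapping.keys p \<union> Poly_Mapping.keys q"
  have M: "finite M" "Poly_Mapping.keys p \<subseteq> M" "Poly_Mapping.keys q \<subseteq> M" "Poly_Mapping.keys (p + q) \<subseteq> M"
    using Poly_Mapping.keys_add[of p q] by (auto simp: M_def)
  have "(\<Oplus>m\<in>M. u (Poly_Mapping.lookup (p + q) m) \<otimes> monomial_value m) =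
    (\<Oplus>m\<in>M. u (Poly_Mapping.lookup p m) \<otimes> monomial_value m
            \<oplus> u (Poly_Mapping.lookup q m) \<otimes> monomial_value m)"
    by (rule finsum_cong') (auto simp: lookup_add l_distr)
  also have "\<dots> = (\<Oplus>m\<in>M. u (Poly_Mapping.lookup p m) \<otimes> monomial_value m) \<oplus>
      (\<Oplus>m\<in>M. u (Poly_Mapping.lookup q m) \<otimes> monomial_value m)"
    by (rule finsum_addf) auto
  finally show ?thesis
    by (simp only: evaluate_superset[OF M(1) M(2)] evaluate_superset[OF M(1) M(3)]
        evaluate_superset[OF M(1) M(4)])
qed

lemma evaluate_single: "evaluate (Poly_Mapping.single m c) = u c \<otimes> monomial_value m"
  by (subst evaluate_superset[of "{m}"]) auto

lemma evaluate_zero: "evaluate 0 = \<zero>"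
  by (simp add: evaluate_def)

lemma evaluate_mult: "evaluate (p * q) = evaluate p \<otimes> evaluate q"
proof -
  have split: "Poly_Mapping.update m c p = Poly_Mapping.single m c + p" if "m \<notin> Poly_Mapping.keys p"
    for m c and p :: "('v, 'k) mpoly"
    using that
    by (intro poly_mapping_eqI) (auto simp: lookup_update lookup_add lookup_single in_keys_iff)
  have single: "evaluate (Poly_Mapping.single m c * q) = evaluate (Poly_Mapping.single m c) \<otimes> evaluate q" for m c
  proof (induction q rule: update_induct)
    case const
    then show ?case by (simp add: evaluate_zero)
  next
    case (update q n d)
    have "evaluate (Poly_Mapping.single m c * Poly_Mapping.single n d)
        = evaluate (Poly_Mapping.single m c) \<otimes> evaluate (Poly_Mapping.single n d)"
      by (simp add: mult_single evaluate_single monomial_value_add m_ac)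
    with update.IH show ?case
      by (simp add: split[OF update.hyps(1)] distrib_left evaluate_add r_distr)
  qed
  show ?thesis
  proof (induction p rule: update_induct)
    case const
    then show ?case by (simp add: evaluate_zero)
  next
    case (update p n d)
    then show ?case
      by (simp add: split[OF update.hyps(1)] distrib_right evaluate_add l_distr single)
  qed
qed

lemma evaluate_Const: "evaluate (Const c) = u c"
  by (simp add: Const_def evaluate_single monomial_value_def)

lemma evaluate_Var: "evaluate (Var v) = \<sigma> v"
  by (simp add: Var_def evaluate_single monomial_value_superset[of "{v}"])

lemma evaluate_hom: "evaluate \<in> Ring.ring_hom ring_of_type_algebra C"
  using evaluate_Const[of 1]
  by (intro ring_hom_memI) (auto simp: evaluate_add evaluate_mult Const_def)

lemma evaluate_hom_mp_ring: "evaluate \<in> Ring.ring_hom (mp_ring V) C"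
  using evaluate_Const[of 1]
  by (intro ring_hom_memI) (auto simp: evaluate_add evaluate_mult Const_def)

end

text \<open>The uniqueness half of the universal property of the polynomial ring.\<close>

lemma mpoly_hom_eqI:
  assumes hom: "h \<in> Ring.ring_hom (mp_ring V) C" "h' \<in> Ring.ring_hom (mp_ring V) C"
    and "\<And>c. h (Const c) = h' (Const c)" "\<And>v. v \<in> V \<Longrightarrow> h (Var v) = h' (Var v)"
    and "p \<in> carrier (mp_ring V)"
  shows "h p = h' p"
  using assms(5)
proof (induction p rule: mp_ring_induct)
  case (add p q)
  with hom[THEN ring_hom_add, OF add(1,2)] show ?case by simp
next
  case (mult p q)
  with hom[THEN ring_hom_mult, OF mult(1,2)] show ?case by simp
qed (use assms in auto)

text \<open>
  Read in the ring of all elements of a type, the evaluation becomes \<^const>\<open>mp_eval\<close>, which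
  therefore inherits the homomorphism properties.
\<close>

lemma finsum_type_algebra: "finsum (ring_of_type_algebra :: 'a::comm_ring_1 ring) f A = sum f A"
proof -
  interpret cring "ring_of_type_algebra :: 'a ring" by (rule cring_from_type_algebra)
  show ?thesis
    by (induction A rule: infinite_finite_induct) (simp_all add: finsum_infinite)
qed

lemma pow_type_algebra: "x [^]\<^bsub>ring_of_type_algebra\<^esub> (n::nat) = (x::'a::comm_ring_1) ^ n"
proof -
  interpret cring "ring_of_type_algebra :: 'a ring" by (rule cring_from_type_algebra)
  show ?thesis by (induction n) (simp_all add: mult.commute)
qed

lemma finprod_type_algebra: "finprod (ring_of_type_algebra :: 'a::comm_ring_1 ring) f A = prod f A"
proof -
  interpret cring "ring_of_type_algebra :: 'a ring" by (rule cring_from_type_algebra)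
  show ?thesis
    by (induction A rule: infinite_finite_induct) (simp_all add: finprod_infinite)
qed

lemma mp_eval_is_evaluation:
  fixes f :: "'a::comm_ring_1 \<Rightarrow> 'b::comm_ring_1"
  assumes "f \<in> Ring.ring_hom ring_of_type_algebra ring_of_type_algebra"
  shows "mpoly_evaluation ring_of_type_algebra f \<sigma>"
    and "mp_eval f \<sigma> = mpoly_evaluation.evaluate ring_of_type_algebra f \<sigma>"
proof -
  have cr: "cring (ring_of_type_algebra :: 'b ring)" by (rule cring_from_type_algebra)
  show ev: "mpoly_evaluation ring_of_type_algebra f \<sigma>"
    unfolding mpoly_evaluation_def mpoly_evaluation_axioms_def using assms cr by simp
  show "mp_eval f \<sigma> = mpoly_evaluation.evaluate ring_of_type_algebra f \<sigma>"
    unfolding fun_eq_iff mp_eval_def mpoly_evaluation.evaluate_def[OF ev]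
      mpoly_evaluation.monomial_value_def[OF ev] finsum_type_algebra
       finprod_type_algebra pow_type_algebra by simp
qed

section \<open>Products of polynomials modulo an ideal\<close>

lemma subring_ideal_facts:
  assumes "ideal J (ring_of_type_algebra\<lparr>carrier := S\<rparr>)"
  shows "0 \<in> J" "J \<subseteq> S" "0 \<in> S" "1 \<in> S"
    "\<And>x y. x \<in> J \<Longrightarrow> y \<in> J \<Longrightarrow> x + y \<in> J" "\<And>x y. x \<in> J \<Longrightarrow> y \<in> J \<Longrightarrow> x - y \<in> J"
    "\<And>x s. s \<in> S \<Longrightarrow> x \<in> J \<Longrightarrow> s * x \<in> J"
    "\<And>x y. x \<in> S \<Longrightarrow> y \<in> S \<Longrightarrow> x + y \<in> S" "\<And>x y. x \<in> S \<Longrightarrow> y \<in> S \<Longrightarrow> x * y \<in> S"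
proof -
  interpret ideal J "ring_of_type_algebra\<lparr>carrier := S\<rparr>" by fact
  show "0 \<in> J" "J \<subseteq> S" "0 \<in> S" "1 \<in> S"
    and add: "\<And>x y. x \<in> J \<Longrightarrow> y \<in> J \<Longrightarrow> x + y \<in> J"
    and mult: "\<And>x s. s \<in> S \<Longrightarrow> x \<in> J \<Longrightarrow> s * x \<in> J"
    and "\<And>x y. x \<in> S \<Longrightarrow> y \<in> S \<Longrightarrow> x + y \<in> S" "\<And>x y. x \<in> S \<Longrightarrow> y \<in> S \<Longrightarrow> x * y \<in> S"
    using zero_closed one_closed additive_subgroup.zero_closed[OF additive_subgroup_axioms]
      additive_subgroup.a_closed[OF additive_subgroup_axioms] a_subset I_l_closed add.m_closed m_closed
    by simp_all
  show "x - y \<in> J" if "x \<in> J" "y \<in> J" for x y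
  proof -
    have "y \<in> S" using that a_subset by auto
    define z where "z = a_inv (ring_of_type_algebra\<lparr>carrier := S\<rparr>) y"
    have "z + y = 0"
      using l_neg[of y] \<open>y \<in> S\<close> by (simp add: z_def)
    then have "z = - y" by (simp add: eq_neg_iff_add_eq_0)
    moreover have "z \<in> J"
      unfolding z_def by (rule additive_subgroup.a_inv_closed[OF additive_subgroup_axioms that(2)])
    ultimately show ?thesis using add[OF that(1), of z] by simp
  qed
qed

lemma sum_mem_of_add_closed:
  assumes "0 \<in> S" "\<And>x y. x \<in> S \<Longrightarrow> y \<in> S \<Longrightarrow> x + y \<in> S" "\<And>a. a \<in> A \<Longrightarrow> f a \<in> S"
  shows "sum f A \<in> S"
  using assms(3) by (induction A rule: infinite_finite_induct) (auto intro: assms(1,2))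

text \<open>
  This is McCoy's theorem for the ring \<open>S\<close> modulo \<open>J\<close>: a zero divisor among the polynomials is
  annihilated by a nonzero constant, but a constant that annihilates the coefficient 1 is zero.
  McCoy's argument lowers a bound \<open>n\<close> for the degree of \<open>g\<close> modulo \<open>J\<close>.  If some
  product \<open>f\<^sub>i g\<close> is not zero modulo \<open>J\<close>, take the largest such \<open>i\<close>; the leading term of \<open>f g\<close>
  shows that \<open>f\<^sub>i g\<close> has smaller degree than \<open>g\<close>, and \<open>f\<close> annihilates it as well.
\<close>

lemma regular_modulo_ideal_if_coeff_one:
  fixes f g :: "'a::comm_ring_1 poly"
  assumes J: "ideal J (ring_of_type_algebra\<lparr>carrier := S\<rparr>)"
    and f: "\<And>i. Polynomial.coeff f i \<in> S" "Polynomial.coeff f t = 1"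
    and g: "\<And>i. Polynomial.coeff g i \<in> S"
    and fg: "\<And>i. Polynomial.coeff (f * g) i \<in> J"
  shows "Polynomial.coeff g i \<in> J"
proof -
  note J = subring_ideal_facts[OF J]
  have main: "\<forall>i. Polynomial.coeff g i \<in> J"
    if "\<And>i. Polynomial.coeff g i \<in> S" "\<And>i. Polynomial.coeff (f * g) i \<in> J"
      "\<And>i. n \<le> i \<Longrightarrow> Polynomial.coeff g i \<in> J" for n g
    using that
  proof (induction n arbitrary: g)
    case 0
    then show ?case by simp
  next
    case (Suc n g)
    have all: "\<forall>k. Polynomial.coeff f i * Polynomial.coeff g k \<in> J" for i
    proof (rule ccontr)
      define B where "B = {i. \<exists>k. Polynomial.coeff f i * Polynomial.coeff g k \<notin> J}"
      assume "\<not> (\<forall>k. Polynomial.coeff f i * Polynomial.coeff g k \<in> J)"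
      then have "B \<noteq> {}" by (auto simp: B_def)
      have "B \<subseteq> {..Polynomial.degree f}"
        using J(1) by (auto simp: B_def intro: le_degree)
      then have "finite B" by (rule finite_subset) simp
      define m where "m = Max B"
      have m: "m \<in> B" unfolding m_def by (rule Max_in) fact+
      have above: "Polynomial.coeff f i * Polynomial.coeff g k \<in> J" if "m < i" for i k
        using that Max_ge[OF \<open>finite B\<close>, of i] unfolding m_def[symmetric] by (force simp: B_def)
      \<comment> \<open>Among the terms of the coefficient number \<open>m + n\<close> of \<open>f * g\<close>, those with \<open>i > m\<close> are
        in \<open>J\<close> as \<open>m\<close> is maximal, and those with \<open>i < m\<close> because of the bound on the degree of \<open>g\<close>.\<close>
      have "(\<Sum>i\<in>{..m + n} - {m}. Polynomial.coeff f i * Polynomial.coeff g (m + n - i)) \<in> J"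
      proof (rule sum_mem_of_add_closed)
        fix i assume "i \<in> {..m + n} - {m}"
        then consider "m < i" | "Suc n \<le> m + n - i" by fastforce
        then show "Polynomial.coeff f i * Polynomial.coeff g (m + n - i) \<in> J"
          by cases (auto intro: above J(7) f Suc.prems(3))
      qed (auto intro: J)
      moreover have "Polynomial.coeff (f * g) (m + n) =
        Polynomial.coeff f m * Polynomial.coeff g n +
        (\<Sum>i\<in>{..m + n} - {m}. Polynomial.coeff f i * Polynomial.coeff g (m + n - i))"
        by (simp add: coeff_mult sum.remove[of "{..m + n}" m])
      ultimately have "Polynomial.coeff f m * Polynomial.coeff g n \<in> J"
        using J(6)[OF Suc.prems(2)[of "m + n"], of "\<Sum>i\<in>{..m + n} - {m}. Polynomial.coeff f i * Polynomial.coeff g (m + n - i)"]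
        by simp
      moreover have "Polynomial.coeff f m * Polynomial.coeff g k \<in> J" if "Suc n \<le> k" for k
        using that by (intro J(7) f Suc.prems(3))
      ultimately have "\<And>k. n \<le> k \<Longrightarrow> Polynomial.coeff (Polynomial.smult (Polynomial.coeff f m) g) k \<in> J"
        unfolding coeff_smult le_eq_less_or_eq[of n] Suc_le_eq by blast
      moreover have "Polynomial.coeff (f * Polynomial.smult (Polynomial.coeff f m) g) k \<in> J" for k
        unfolding mult_smult_right coeff_smult by (intro J(7) f Suc.prems(2))
      moreover have "Polynomial.coeff (Polynomial.smult (Polynomial.coeff f m) g) k \<in> S" for k
        unfolding coeff_smult by (intro J(9) f Suc.prems(1))
      ultimately have "\<forall>k. Polynomial.coeff (Polynomial.smult (Polynomial.coeff f m) g) k \<in> J"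
        by (intro Suc.IH)
      with m show False by (auto simp: B_def)
    qed
    show ?case using all[of t] f(2) by simp
  qed
  have "\<And>i. Suc (Polynomial.degree g) \<le> i \<Longrightarrow> Polynomial.coeff g i \<in> J"
    using J(1) by (simp add: coeff_eq_0)
  from main[OF g fg this] show ?thesis by simp
qed

lemma coeff_mult_mem:
  fixes p q :: "'a::comm_ring_1 poly"
  assumes "0 \<in> S" "\<And>x y. x \<in> S \<Longrightarrow> y \<in> S \<Longrightarrow> x + y \<in> S" "\<And>x y. x \<in> S \<Longrightarrow> y \<in> S \<Longrightarrow> x * y \<in> S"
    and "\<And>i. Polynomial.coeff p i \<in> S" "\<And>i. Polynomial.coeff q i \<in> S"
  shows "Polynomial.coeff (p * q) i \<in> S"
  unfolding coeff_mult by (intro sum_mem_of_add_closed assms)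

lemma coeff_prod_power_mem:
  fixes f :: "'b \<Rightarrow> 'a::comm_ring_1 poly"
  assumes S: "0 \<in> S" "1 \<in> S" "\<And>x y. x \<in> S \<Longrightarrow> y \<in> S \<Longrightarrow> x + y \<in> S" "\<And>x y. x \<in> S \<Longrightarrow> y \<in> S \<Longrightarrow> x * y \<in> S"
    and f: "\<And>a i. a \<in> A \<Longrightarrow> Polynomial.coeff (f a) i \<in> S"
  shows "Polynomial.coeff (\<Prod>a\<in>A. f a ^ n a) i \<in> S"
proof -
  have one: "Polynomial.coeff 1 i \<in> S" for i
    using S(1,2) by (cases i) simp_all
  have pow: "Polynomial.coeff (f a ^ k) i \<in> S" if "a \<in> A" for a k i
    using that by (induction k arbitrary: i) (auto intro!: one coeff_mult_mem S f)
  show ?thesis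
    using pow
    by (induction A arbitrary: i rule: infinite_finite_induct) (auto intro!: one coeff_mult_mem S)
qed

text \<open>
  The factors can be cancelled one after the other, as each of them is regular modulo \<open>J\<close>; what
  remains in the end is the polynomial 1.
\<close>

lemma unit_ideal_if_coeffs_of_product:
  fixes f :: "'b \<Rightarrow> 'a::comm_ring_1 poly"
  assumes J: "ideal J (ring_of_type_algebra\<lparr>carrier := S\<rparr>)" and "finite A"
    and f: "\<And>a i. a \<in> A \<Longrightarrow> Polynomial.coeff (f a) i \<in> S"
      "\<And>a. a \<in> A \<Longrightarrow> \<exists>t. Polynomial.coeff (f a) t = 1"
    and prod: "\<And>i. Polynomial.coeff (\<Prod>a\<in>A. f a ^ n a) i \<in> J"
  shows "1 \<in> J"
proof -
  note JJ = subring_ideal_facts[OF J]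
  have pow: "Polynomial.coeff g i \<in> J"
    if "a \<in> A" "\<And>i. Polynomial.coeff g i \<in> S" "\<And>i. Polynomial.coeff (f a ^ k * g) i \<in> J" for a k g i
    using that
  proof (induction k arbitrary: g i)
    case (Suc k g i)
    obtain t where "Polynomial.coeff (f a) t = 1" using f(2)[OF Suc.prems(1)] by auto
    moreover have "Polynomial.coeff (f a * g) i \<in> J" for i
    proof (rule Suc.IH[OF Suc.prems(1)])
      show "Polynomial.coeff (f a * g) i \<in> S" for i
        by (rule coeff_mult_mem[OF JJ(3,8,9) f(1)[OF Suc.prems(1)] Suc.prems(2)])
      show "Polynomial.coeff (f a ^ k * (f a * g)) i \<in> J" for i
        using Suc.prems(3)[of i] by (simp add: mult_ac)
    qed
    ultimately show ?case
      by (intro regular_modulo_ideal_if_coeff_one[OF J f(1)[OF Suc.prems(1)] _ Suc.prems(2)])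
  qed simp
  have "Polynomial.coeff g i \<in> J"
    if "B \<subseteq> A" "\<And>i. Polynomial.coeff g i \<in> S"
      "\<And>i. Polynomial.coeff ((\<Prod>a\<in>B. f a ^ n a) * g) i \<in> J" for B g i
    using finite_subset[OF that(1) \<open>finite A\<close>] that
  proof (induction B arbitrary: g i)
    case (insert a B g i)
    have "Polynomial.coeff ((\<Prod>a\<in>B. f a ^ n a) * g) i \<in> J" for i
    proof (rule pow[of a _ "n a"])
      show "Polynomial.coeff ((\<Prod>a\<in>B. f a ^ n a) * g) i \<in> S" for i
        by (rule coeff_mult_mem[OF JJ(3,8,9) coeff_prod_power_mem[OF JJ(3,4,8,9) f(1)]])
          (use insert.prems in auto)
      show "Polynomial.coeff (f a ^ n a * ((\<Prod>a\<in>B. f a ^ n a) * g)) i \<in> J" for i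
        using insert.prems(3)[of i] insert.hyps by (simp add: mult.assoc)
    qed (use insert.prems in auto)
    then show ?case using insert by simp
  qed simp
  from this[of A 1 0] prod JJ(3,4) show ?thesis
    by (simp add: coeff_1)
qed

section \<open>Dehomogenized products of binary forms\<close>

definition homogeneous :: "nat \<Rightarrow> 'b::comm_ring_1 poly poly \<Rightarrow> bool" where
  "homogeneous n F \<longleftrightarrow> (\<forall>i j. Polynomial.coeff (Polynomial.coeff F i) j \<noteq> 0 \<longrightarrow> i + j = n)"

lemma homogeneous_mult:
  assumes "homogeneous m F" "homogeneous n G"
  shows "homogeneous (m + n) (F * G)"
  unfolding homogeneous_def
proof (intro allI impI)
  fix i j assume "Polynomial.coeff (Polynomial.coeff (F * G) i) j \<noteq> 0"
  then obtain a b where "a \<le> i" "b \<le> j"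
    "Polynomial.coeff (Polynomial.coeff F a) b * Polynomial.coeff (Polynomial.coeff G (i - a)) (j - b) \<noteq> 0"
    unfolding coeff_mult coeff_sum by (metis (no_types, lifting) sum.neutral atMost_iff)
  moreover from this(3) have "a + b = m" "i - a + (j - b) = n"
    using assms unfolding homogeneous_def by force+
  ultimately show "i + j = m + n" by simp
qed

lemma homogeneous_one: "homogeneous 0 1"
  by (auto simp: homogeneous_def coeff_1 split: if_splits)

lemma homogeneous_prod_power:
  assumes "\<And>a. a \<in> A \<Longrightarrow> homogeneous (k a) (F a)"
  shows "homogeneous (\<Sum>a\<in>A. n a * k a) (\<Prod>a\<in>A. F a ^ n a)"
proof -
  have "homogeneous (m * k a) (F a ^ m)" if "a \<in> A" for a m
    by (induction m) (use that assms in \<open>auto intro: homogeneous_mult homogeneous_one\<close>)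
  then show ?thesis
    by (induction A rule: infinite_finite_induct) (auto intro: homogeneous_mult homogeneous_one)
qed

lemma homogeneous_binary_form: "homogeneous k (binary_form k b)"
  by (auto simp: homogeneous_def binary_form_def coeff_sum if_distrib cong: if_cong
           elim!: sum.not_neutral_contains_not_neutral split: if_splits)

text \<open>
  Setting \<open>x = 1\<close> loses nothing on homogeneous polynomials: the coefficient of \<open>y\<^sup>j\<close> can only come
  from the monomial \<open>x\<^bsup>n-j\<^esup> y\<^sup>j\<close>.
\<close>

lemma coeff_dehomogenization:
  assumes "homogeneous n F"
  shows "Polynomial.coeff (poly F 1) j = (if j \<le> n then Polynomial.coeff (Polynomial.coeff F (n - j)) j else 0)"
proof -
  have zero: "Polynomial.coeff (Polynomial.coeff F i) j = 0" if "i + j \<noteq> n" for i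
    using assms that by (auto simp: homogeneous_def)
  have "Polynomial.coeff (poly F 1) j = (\<Sum>i\<le>Polynomial.degree F. Polynomial.coeff (Polynomial.coeff F i) j)"
    by (simp add: poly_altdef coeff_sum)
  also have "\<dots> = (\<Sum>i\<le>Polynomial.degree F. if i + j = n then Polynomial.coeff (Polynomial.coeff F i) j else 0)"
    by (intro sum.cong) (auto simp: zero)
  also have "\<dots> = (if j \<le> n then Polynomial.coeff (Polynomial.coeff F (n - j)) j else 0)"
  proof (cases "j \<le> n")
    case True
    then have "i + j = n \<longleftrightarrow> i = n - j" for i by auto
    then show ?thesis using True by (auto simp: coeff_eq_0)
  qed simp
  finally show ?thesis .
qed

definition dehomogenized_product :: "nat \<Rightarrow> (nat \<Rightarrow> nat) \<Rightarrow> (nat \<times> nat \<Rightarrow> 'b::comm_ring_1) \<Rightarrow> 'b poly" where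
  "dehomogenized_product d e b = (\<Prod>r=1..d. (\<Sum>t\<le>e r. Polynomial.monom (b (r, t)) t) ^ r)"

lemma coeff_sum_monom:
  "Polynomial.coeff (\<Sum>t\<le>k. Polynomial.monom (b t) t) i = (if i \<le> k then b i else 0)"
  by (simp add: coeff_sum)

text \<open>
  The hypothesis on \<open>e\<close> says that the product of the forms has degree \<open>d\<close>.
\<close>

lemma coeff_dehomogenized_product:
  assumes "(\<Sum>r=1..d. r * e r) = d"
  shows "Polynomial.coeff (dehomogenized_product d e b) j = (if j \<le> d then
    Polynomial.coeff (Polynomial.coeff (\<Prod>r=1..d. binary_form (e r) (\<lambda>t. b (r, t)) ^ r) (d - j)) j else 0)"
proof -
  let ?F = "\<Prod>r=1..d. binary_form (e r) (\<lambda>t. b (r, t)) ^ r"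
  have "homogeneous d ?F"
    using homogeneous_prod_power[of "{1..d}" e "\<lambda>r. binary_form (e r) (\<lambda>t. b (r, t))" "\<lambda>r. r"]
    by (simp add: homogeneous_binary_form assms del: One_nat_def)
  moreover have "poly ?F 1 = dehomogenized_product d e b"
    by (simp add: dehomogenized_product_def binary_form_def poly_prod poly_sum poly_monom)
  ultimately show ?thesis
    using coeff_dehomogenization[of d ?F j] by simp
qed

lemma Theta_eq_coeff:
  assumes "(\<Sum>r=1..d. r * e r) = d" "j \<le> d"
  shows "Theta d e j = Polynomial.coeff (dehomogenized_product d e Var) j"
  unfolding Theta_def using assms(2) by (simp add: coeff_dehomogenized_product[OF assms(1)])

lemma coeff_dehomogenized_product_mem:
  assumes S: "0 \<in> S" "1 \<in> S" "\<And>x y. x \<in> S \<Longrightarrow> y \<in> S \<Longrightarrow> x + y \<in> S" "\<And>x y. x \<in> S \<Longrightarrow> y \<in> S \<Longrightarrow> x * y \<in> S"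
    and "\<And>r t. r \<in> {1..d} \<Longrightarrow> t \<le> e r \<Longrightarrow> b (r, t) \<in> S"
  shows "Polynomial.coeff (dehomogenized_product d e b) i \<in> S"
  unfolding dehomogenized_product_def
  by (rule coeff_prod_power_mem) (use assms in \<open>auto simp: coeff_sum_monom\<close>)

lemma hom_coeff_dehomogenized_product:
  fixes h :: "'a::comm_ring_1 \<Rightarrow> 'b::comm_ring_1"
  assumes "h \<in> Ring.ring_hom ring_of_type_algebra ring_of_type_algebra"
  shows "h (Polynomial.coeff (dehomogenized_product d e b) j) =
    Polynomial.coeff (dehomogenized_product d e (\<lambda>v. h (b v))) j"
proof -
  have h: "h (x + y) = h x + h y" "h (x * y) = h x * h y" "h 1 = 1" for x y
    using ring_hom_add[OF assms] ring_hom_mult[OF assms] ring_hom_one[OF assms] by simp_all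
  have h0: "h 0 = 0" using h(1)[of 0 0] by simp
  have h_sum: "h (sum f A) = (\<Sum>a\<in>A. h (f a))" for f :: "nat \<Rightarrow> 'a" and A
    by (induction A rule: infinite_finite_induct) (simp_all add: h h0)
  have mult: "map_poly h (p * q) = map_poly h p * map_poly h q" for p q
    by (rule poly_eqI) (simp add: coeff_map_poly coeff_mult h0 h_sum h)
  have pow: "map_poly h (p ^ n) = map_poly h p ^ n" for p n
    by (induction n) (simp_all add: mult map_poly_1' h)
  have prod: "map_poly h (prod f A) = (\<Prod>a\<in>A. map_poly h (f a))" for f :: "nat \<Rightarrow> 'a poly" and A
    by (induction A rule: infinite_finite_induct) (simp_all add: mult map_poly_1' h)
  have "map_poly h (\<Sum>t\<le>k. Polynomial.monom (c t) t) = (\<Sum>t\<le>k. Polynomial.monom (h (c t)) t)" for k c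
    by (rule poly_eqI) (simp add: coeff_map_poly coeff_sum_monom h0)
  then have "map_poly h (dehomogenized_product d e b) = dehomogenized_product d e (\<lambda>v. h (b v))"
    by (simp add: dehomogenized_product_def prod pow)
  then show ?thesis by (metis coeff_map_poly h0)
qed

text \<open>
  Passing from one chart to another rescales the coordinates \<open>b r\<close> of a point by a factor \<open>c r\<close>,
  so the coefficients of the product at the point are rescaled by a common factor.
\<close>

lemma dehomogenized_product_scale:
  "dehomogenized_product d e (\<lambda>(r, t). c r * b (r, t)) =
    Polynomial.smult (\<Prod>r=1..d. c r ^ r) (dehomogenized_product d e b)"
proof -
  have "(\<Sum>t\<le>k. Polynomial.monom (c r * b (r, t)) t) =
      Polynomial.smult (c r) (\<Sum>t\<le>k. Polynomial.monom (b (r, t)) t)" for r k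
    by (rule poly_eqI) (simp add: coeff_sum_monom)
  moreover have "(\<Prod>r\<in>A. Polynomial.smult (c r ^ r) (f r)) = Polynomial.smult (\<Prod>r\<in>A. c r ^ r) (prod f A)" for f A
    by (induction A rule: infinite_finite_induct) (simp_all add: mult_ac)
  ultimately show ?thesis
    by (simp add: dehomogenized_product_def smult_power)
qed

lemma dehomogenized_product_nonzero:
  fixes b :: "nat \<times> nat \<Rightarrow> 'b::idom"
  assumes "\<And>r. r \<in> {1..d} \<Longrightarrow> \<exists>t\<le>e r. b (r, t) \<noteq> 0"
  shows "dehomogenized_product d e b \<noteq> 0"
proof -
  have "(\<Sum>t\<le>e r. Polynomial.monom (b (r, t)) t) \<noteq> 0" if "r \<in> {1..d}" for r
    using assms[OF that] coeff_sum_monom[of "\<lambda>t. b (r, t)" "e r"] by (metis coeff_0)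
  then show ?thesis by (simp add: dehomogenized_product_def)
qed

lemma Const_hom: "Const \<in> Ring.ring_hom ring_of_type_algebra ring_of_type_algebra"
  by (intro ring_hom_memI) (simp_all add: Const_def single_add mult_single)

lemma id_hom: "(\<lambda>c. c) \<in> Ring.ring_hom ring_of_type_algebra ring_of_type_algebra"
  by (intro ring_hom_memI) simp_all

lemma mp_eval_hom:
  assumes "f \<in> Ring.ring_hom ring_of_type_algebra ring_of_type_algebra"
  shows "mp_eval f \<sigma> \<in> Ring.ring_hom ring_of_type_algebra ring_of_type_algebra"
    and "mp_eval f \<sigma> (Const c) = f c"
    and "mp_eval f \<sigma> (Var v) = \<sigma> v"
    and "mp_eval f \<sigma> 1 = 1"
    and "mp_eval f \<sigma> (p + q) = mp_eval f \<sigma> p + mp_eval f \<sigma> q"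
    and "mp_eval f \<sigma> (p - q) = mp_eval f \<sigma> p - mp_eval f \<sigma> q"
    and "mp_eval f \<sigma> (p * q) = mp_eval f \<sigma> p * mp_eval f \<sigma> q"
proof -
  interpret mpoly_evaluation ring_of_type_algebra f \<sigma>
    by (rule mp_eval_is_evaluation(1)[OF assms])
  note eq = mp_eval_is_evaluation(2)[OF assms, of \<sigma>]
  show hom: "mp_eval f \<sigma> \<in> Ring.ring_hom ring_of_type_algebra ring_of_type_algebra"
    unfolding eq by (rule evaluate_hom)
  show "mp_eval f \<sigma> (Const c) = f c" "mp_eval f \<sigma> (Var v) = \<sigma> v"
    unfolding eq by (rule evaluate_Const evaluate_Var)+
  show add: "mp_eval f \<sigma> (p + q) = mp_eval f \<sigma> p + mp_eval f \<sigma> q" for p q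
    using ring_hom_add[OF hom, of p q] by simp
  from add[of "p - q" q] show "mp_eval f \<sigma> (p - q) = mp_eval f \<sigma> p - mp_eval f \<sigma> q"
    by (simp add: eq_diff_eq)
  show "mp_eval f \<sigma> (p * q) = mp_eval f \<sigma> p * mp_eval f \<sigma> q" "mp_eval f \<sigma> 1 = 1"
    using ring_hom_mult[OF hom, of p q] ring_hom_one[OF hom] by simp_all
qed

section \<open>The ideal of the minors\<close>

lemma theta_eq_coeff:
  assumes "(\<Sum>r=1..d. r * e r) = d" "j \<le> d"
  shows "theta d e \<alpha> j = Polynomial.coeff (dehomogenized_product d e (normalized_var \<alpha>)) j"
  by (simp add: theta_def Theta_eq_coeff[OF assms] mp_eval_hom(3)[OF Const_hom]
      hom_coeff_dehomogenized_product[OF mp_eval_hom(1)[OF Const_hom]])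

lemma set_chart_vars: "v \<in> set (chart_vars d e \<alpha>) \<longleftrightarrow> fst v \<le> d \<and> snd v \<le> e (fst v) \<and> snd v \<noteq> \<alpha> (fst v)"
  by (cases v) (auto simp: chart_vars_def less_Suc_eq_le simp del: upt_Suc)

text \<open>
  The coordinates \<open>w\<close> of the chart.  They are separated from the \<open>z\<^sub>j\<close> because the \<open>\<theta>\<^sub>j\<close> do not
  involve the latter.
\<close>

definition parameter_vars :: "nat \<Rightarrow> (nat \<Rightarrow> nat) \<Rightarrow> (nat \<Rightarrow> nat) \<Rightarrow> (nat \<times> nat) set" where
  "parameter_vars d e \<alpha> = {v \<in> set (chart_vars d e \<alpha>). fst v \<noteq> 0}"

lemma theta_parameter_vars:
  assumes "(\<Sum>r=1..d. r * e r) = d" "j \<le> d"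
  shows "theta d e \<alpha> j \<in> carrier (mp_ring (parameter_vars d e \<alpha>))"
  unfolding theta_eq_coeff[OF assms]
  by (rule coeff_dehomogenized_product_mem)
     (auto simp: normalized_var_def parameter_vars_def set_chart_vars)

lemma theta_chart_ring:
  assumes "(\<Sum>r=1..d. r * e r) = d" "j \<le> d"
  shows "theta d e \<alpha> j \<in> carrier (chart_ring d e \<alpha>)"
  using theta_parameter_vars[OF assms] mp_ring_mono[of "parameter_vars d e \<alpha>" "set (chart_vars d e \<alpha>)"]
  unfolding chart_ring_def by (auto simp: parameter_vars_def)

lemma normalized_var_chart_ring:
  assumes "e 0 = d" "j \<le> d"
  shows "normalized_var \<alpha> (0, j) \<in> carrier (chart_ring d e \<alpha>)"
  using assms by (auto simp: normalized_var_def chart_ring_def set_chart_vars)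

lemma det_2_by_2:
  assumes "A \<in> carrier_mat 2 2"
  shows "det A = A $$ (0, 0) * A $$ (1, 1) - A $$ (0, 1) * A $$ (1, 0)"
proof -
  have "det A = (\<Sum>i<2. A $$ (i, 0) * cofactor A i 0)"
    by (rule laplace_expansion_column[OF assms]) simp
  also have "\<dots> = A $$ (0, 0) * cofactor A 0 0 + A $$ (1, 0) * cofactor A 1 0"
    by (simp add: numeral_2_eq_2)
  also have "cofactor A 0 0 = A $$ (1, 1)"
    using assms by (simp add: cofactor_def det_single mat_delete_def)
  also have "cofactor A 1 0 = - (A $$ (0, 1))"
    using assms by (simp add: cofactor_def det_single mat_delete_def)
  finally show ?thesis by (simp add: mult.commute)
qed

lemma pick_doubleton:
  assumes "i < j"
  shows "pick {i, j} 0 = i" "pick {i, j} (Suc 0) = j"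
proof -
  show 0: "pick {i, j} 0 = i"
    using assms by (auto intro!: Least_equality)
  show "pick {i, j} (Suc 0) = j"
    using assms unfolding pick.simps(2) 0 by (auto intro!: Least_equality)
qed

lemma det_submatrix_2:
  assumes "dim_row A = 2" "i < j" "j < dim_col A"
  shows "det (submatrix A {..<2} {i, j}) = A $$ (0, i) * A $$ (1, j) - A $$ (0, j) * A $$ (1, i)"
proof -
  have rows: "{k. k < dim_row A \<and> k \<in> {..<2}} = {0, 1}" "{..<2} = {0, 1::nat}" using assms(1) by auto
  have cols: "{k. k < dim_col A \<and> k \<in> {i, j}} = {i, j}" using assms(2,3) by auto
  have card: "card {i, j} = 2" "card {0, 1::nat} = 2"
    using assms(2) by (simp_all add: numeral_2_eq_2)
  have dim: "submatrix A {..<2} {i, j} \<in> carrier_mat 2 2"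
    by (intro carrier_matI) (simp_all only: dim_submatrix rows(1) cols card)
  have "submatrix A {..<2} {i, j} $$ (a, b) = A $$ (pick {0, 1} a, pick {i, j} b)" if "a < 2" "b < 2" for a b
    using that unfolding rows(2)[symmetric]
    by (intro submatrix_index) (simp_all only: rows(1) cols card)
  then show ?thesis
    unfolding det_2_by_2[OF dim] using pick_doubleton[OF assms(2)] pick_doubleton[of 0 1]
    by (simp del: pick.simps)
qed

lemma minors_2:
  assumes "dim_row A = 2"
  shows "minors 2 A = {A $$ (0, i) * A $$ (1, j) - A $$ (0, j) * A $$ (1, i) | i j. i < j \<and> j < dim_col A}"
    (is "?L = ?R")
proof (intro equalityI subsetI)
  fix x assume "x \<in> ?L"
  then obtain I J where x: "x = det (submatrix A I J)" and I: "I \<subseteq> {..<2}" "card I = 2"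
    and J: "J \<subseteq> {..<dim_col A}" "card J = 2"
    by (auto simp: minors_def assms)
  have "I = {..<2}" using I by (intro card_subset_eq) auto
  moreover obtain i j where "J = {i, j}" "i < j"
    using J(2) unfolding card_2_iff by (metis insert_commute linorder_neqE_nat)
  ultimately show "x \<in> ?R" using J(1) det_submatrix_2[OF assms] x by auto
next
  fix x assume "x \<in> ?R"
  then obtain i j where ij: "i < j" "j < dim_col A"
    and x: "x = det (submatrix A {..<2} {i, j})" using det_submatrix_2[OF assms] by auto
  moreover have "{i, j} \<subseteq> {..<dim_col A}" "card {i, j} = 2"
    using ij by auto
  moreover have "{..<2} \<subseteq> {..<dim_row A}" "card {..<2::nat} = 2"
    using assms by auto
  ultimately show "x \<in> ?L"
    unfolding minors_def mem_Collect_eq by blast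
qed

lemma minors_phi_mat:
  "minors 2 (phi_mat d e \<alpha> :: (nat \<times> nat, 'a::field) mpoly mat) = {theta d e \<alpha> i * normalized_var \<alpha> (0, j) - theta d e \<alpha> j * normalized_var \<alpha> (0, i)
     | i j. i < j \<and> j \<le> d}"
proof -
  let ?M = "phi_mat d e \<alpha> :: (nat \<times> nat, 'a) mpoly mat"
  have dim: "dim_row ?M = 2" "dim_col ?M = d + 1"
    by (simp_all add: phi_mat_def)
  have "?M $$ (0, i) = theta d e \<alpha> i" "?M $$ (1, i) = normalized_var \<alpha> (0, i)"
    if "i \<le> d" for i using that by (simp_all add: phi_mat_def)
  then have "?M $$ (0, i) * ?M $$ (1, j) - ?M $$ (0, j) * ?M $$ (1, i)
     = theta d e \<alpha> i * normalized_var \<alpha> (0, j) - theta d e \<alpha> j * normalized_var \<alpha> (0, i)"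
    if "i < j" "j \<le> d" for i j
    using that less_imp_le[OF that(1)] by (simp add: order_trans[of i j d])
  then show ?thesis
    unfolding minors_2[OF dim(1)] dim(2) by (intro Collect_cong ex_cong1) (auto simp: less_Suc_eq_le)
qed

lemma chart_ring_cring: "cring (chart_ring d e \<alpha>)"
  unfolding chart_ring_def by (rule mp_ring_cring)

lemma chart_ring_simps [simp]:
  "x \<otimes>\<^bsub>chart_ring d e \<alpha>\<^esub> y = x * y"
  "x \<oplus>\<^bsub>chart_ring d e \<alpha>\<^esub> y = x + y"
  "\<one>\<^bsub>chart_ring d e \<alpha>\<^esub> = 1"
  "\<zero>\<^bsub>chart_ring d e \<alpha>\<^esub> = 0"
  by (simp_all add: chart_ring_def)

lemma minors_chart_ring:
  assumes "(\<Sum>r=1..d. r * e r) = d" "e 0 = d"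
  shows "minors 2 (phi_mat d e \<alpha>) \<subseteq> carrier (chart_ring d e \<alpha> :: (nat \<times> nat, 'a::field) mpoly ring)"
proof -
  have "theta d e \<alpha> i * normalized_var \<alpha> (0, j) - theta d e \<alpha> j * normalized_var \<alpha> (0, i)
      \<in> carrier (chart_ring d e \<alpha> :: (nat \<times> nat, 'a) mpoly ring)" if "i \<le> d" "j \<le> d" for i j
    using theta_chart_ring[OF assms(1) that(1)] theta_chart_ring[OF assms(1) that(2)]
      normalized_var_chart_ring[of e d i \<alpha>, OF assms(2) that(1)] normalized_var_chart_ring[of e d j \<alpha>, OF assms(2) that(2)]
    unfolding chart_ring_def by (intro mp_ring_closed)
  then show ?thesis unfolding minors_phi_mat by (auto intro: less_imp_le order_trans)
qed

lemma T_phi_ideal: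
  assumes "(\<Sum>r=1..d. r * e r) = d" "e 0 = d"
  shows "ideal (T_phi d e \<alpha>) (chart_ring d e \<alpha>)"
  unfolding T_phi_def
  by (rule ring.genideal_ideal[OF cring.axioms(1)[OF chart_ring_cring] minors_chart_ring[OF assms]])

lemma minor_mem_T_phi:
  assumes "(\<Sum>r=1..d. r * e r) = d" "e 0 = d" "i \<le> d" "j \<le> d"
  shows "theta d e \<alpha> i * normalized_var \<alpha> (0, j) - theta d e \<alpha> j * normalized_var \<alpha> (0, i) \<in> (T_phi d e \<alpha> :: (nat \<times> nat, 'a::field) mpoly set)"
proof -
  have sub: "minors 2 (phi_mat d e \<alpha>) \<subseteq> (T_phi d e \<alpha> :: (nat \<times> nat, 'a) mpoly set)"
    unfolding T_phi_def
    by (rule ring.genideal_self[OF cring.axioms(1)[OF chart_ring_cring] minors_chart_ring[OF assms(1,2)]])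
  note facts = subring_ideal_facts[OF T_phi_ideal[OF assms(1,2), unfolded chart_ring_def mp_ring_def]]
  consider "i < j" | "i = j" | "j < i" by linarith
  then show ?thesis
  proof cases
    case 1
    with assms sub show ?thesis by (auto simp: minors_phi_mat)
  next
    case 2
    then show ?thesis by (simp add: facts(1))
  next
    case 3
    then have "theta d e \<alpha> j * normalized_var \<alpha> (0, i) - theta d e \<alpha> i * normalized_var \<alpha> (0, j) \<in> (T_phi d e \<alpha> :: (nat \<times> nat, 'a) mpoly set)"
      using assms sub by (auto simp: minors_phi_mat)
    from facts(6)[OF facts(1) this] show ?thesis by simp
  qed
qed

lemma mp_eval_theta:
  assumes "(\<Sum>r=1..d. r * e r) = d" "j \<le> d" "q \<in> U_points d e \<gamma>"
  shows "mp_eval (\<lambda>c. c) (affine_coords \<gamma> q) (theta d e \<gamma> j) =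
    (\<Prod>r=1..d. (1 / q r (\<gamma> r)) ^ r) * Polynomial.coeff (dehomogenized_product d e (\<lambda>(r, t). q r t)) j"
proof -
  have "mp_eval (\<lambda>c. c) (affine_coords \<gamma> q) (normalized_var \<gamma> (r, t)) = 1 / q r (\<gamma> r) * q r t" if "r \<le> d" for r t
    using that assms(3)
    by (auto simp: normalized_var_def U_points_def affine_coords_def mp_eval_hom(3,4)[OF id_hom])
  then have "dehomogenized_product d e (\<lambda>v. mp_eval (\<lambda>c. c) (affine_coords \<gamma> q) (normalized_var \<gamma> v))
    = dehomogenized_product d e (\<lambda>(r, t). 1 / q r (\<gamma> r) * (case (r, t) of (r, t) \<Rightarrow> q r t))"
    unfolding dehomogenized_product_def by (intro prod.cong) auto
  then show ?thesis
    by (simp only: theta_eq_coeff[OF assms(1,2)] hom_coeff_dehomogenized_product[OF mp_eval_hom(1)[OF id_hom]]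
       dehomogenized_product_scale[of d e "\<lambda>r. 1 / q r (\<gamma> r)" "\<lambda>(r, t). q r t"] coeff_smult)
qed

section \<open>The Jacobian matrix\<close>

text \<open>
  The chart \<open>\<beta>\<close> that exhibits \<open>q\<close> as a point of the subscheme may differ from \<open>\<alpha>\<close>.  Therefore
  the argument is carried out with the product \<open>Q\<close> of the forms in the given homogeneous
  coordinates of \<open>q\<close>: in each chart the \<open>\<theta>\<^sub>j\<close> are the coefficients of \<open>Q\<close> up to a nonzero factor.
  The minors make these coefficients proportional to \<open>q 0\<close>, whose entry \<open>\<alpha> 0\<close> is not zero.
\<close>

lemma theta_nonzero_at_point:
  fixes q :: "nat \<Rightarrow> nat \<Rightarrow> 'a::field"
  assumes sum: "(\<Sum>r=1..d. r * e r) = d" and e0: "e 0 = d"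
    and q: "q \<in> subscheme_points d e (T_phi d e)" and \<alpha>: "\<alpha> \<in> chart_indices d e" "q \<in> U_points d e \<alpha>"
  shows "mp_eval (\<lambda>c. c) (affine_coords \<alpha> q) (theta d e \<alpha> (\<alpha> 0)) \<noteq> 0"
proof -
  define Q where "Q = dehomogenized_product d e (\<lambda>(r, t). q r t)"
  obtain \<beta> where \<beta>: "q \<in> U_points d e \<beta>"
    "\<And>f. f \<in> T_phi d e \<beta> \<Longrightarrow> mp_eval (\<lambda>c. c) (affine_coords \<beta> q) f = 0"
    using q by (auto simp: subscheme_points_def)
  have scalar: "(\<Prod>r=1..d. (1 / q r (\<gamma> r)) ^ r) \<noteq> 0" if "q \<in> U_points d e \<gamma>" for \<gamma>
    using that by (auto simp: U_points_def)
  have z: "mp_eval (\<lambda>c. c) (affine_coords \<beta> q) (normalized_var \<beta> (0, j)) = q 0 j / q 0 (\<beta> 0)" for j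
    using \<beta>(1) by (auto simp: normalized_var_def U_points_def affine_coords_def mp_eval_hom(3,4)[OF id_hom])
  have proportional: "Polynomial.coeff Q i * q 0 j = Polynomial.coeff Q j * q 0 i" if "i \<le> d" "j \<le> d" for i j
  proof -
    have "(\<Prod>r=1..d. (1 / q r (\<beta> r)) ^ r) * (Polynomial.coeff Q i * q 0 j - Polynomial.coeff Q j * q 0 i) / q 0 (\<beta> 0) = 0"
      using \<beta>(2)[OF minor_mem_T_phi[OF sum e0 that]] that
      by (simp add: mp_eval_hom(6,7)[OF id_hom] mp_eval_theta[OF sum _ \<beta>(1)] z Q_def[symmetric] algebra_simps
          diff_divide_distrib)
    then show ?thesis
      using scalar[OF \<beta>(1)] \<beta>(1) by (simp add: U_points_def)
  qed
  have "\<alpha> 0 \<le> d"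
    using \<alpha>(1) e0 by (auto simp: chart_indices_def)
  have "Polynomial.coeff Q (\<alpha> 0) \<noteq> 0"
  proof
    assume 0: "Polynomial.coeff Q (\<alpha> 0) = 0"
    have "Polynomial.coeff Q j = 0" for j
    proof (cases "j \<le> d")
      case True
      then show ?thesis
        using proportional[OF True \<open>\<alpha> 0 \<le> d\<close>] 0 \<alpha>(2) by (auto simp: U_points_def)
    next
      case False
      then show ?thesis by (simp add: Q_def coeff_dehomogenized_product[OF sum])
    qed
    then have "Q = 0" by (intro poly_eqI) simp
    moreover have "Q \<noteq> 0"
      unfolding Q_def using \<alpha>(2) by (intro dehomogenized_product_nonzero) (auto simp: U_points_def T_points_def)
    ultimately show False by simp
  qed
  then show ?thesis
    using scalar[OF \<alpha>(2)] mp_eval_theta[OF sum \<open>\<alpha> 0 \<le> d\<close> \<alpha>(2)] by (simp add: Q_def)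
qed

text \<open>
  A monomial \<open>n\<close> contributes to the coefficient of \<open>m\<close> only if \<open>n\<close> is \<open>m\<close> times the variable \<open>v\<close>.
  The truncated subtraction in the definition of the derivative does no harm, as it occurs with
  the factor 0.
\<close>

lemma lookup_mp_deriv:
  "Poly_Mapping.lookup (mp_deriv v p) m =
    of_nat (Poly_Mapping.lookup m v + 1) * Poly_Mapping.lookup p (m + Poly_Mapping.single v 1)"
proof -
  let ?e = "Poly_Mapping.single v (1::nat)"
  have *: "n - ?e = m \<longleftrightarrow> n = m + ?e" if "Poly_Mapping.lookup n v \<noteq> 0" for n
  proof
    assume m: "n - ?e = m"
    show "n = m + ?e"
      unfolding m[symmetric] using that
      by (intro poly_mapping_eqI) (auto simp: lookup_add lookup_minus lookup_single when_def)
  qed simp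
  have "Poly_Mapping.lookup (mp_deriv v p) m =
    (\<Sum>n\<in>Poly_Mapping.keys p. of_nat (Poly_Mapping.lookup n v) * Poly_Mapping.lookup p n when n - ?e = m)"
    by (simp add: mp_deriv_def lookup_sum lookup_single)
  also have "\<dots> = (\<Sum>n\<in>Poly_Mapping.keys p. if n = m + ?e then of_nat (Poly_Mapping.lookup m v + 1) * Poly_Mapping.lookup p (m + ?e) else 0)"
  proof (intro sum.cong refl)
    fix n
    show "(of_nat (Poly_Mapping.lookup n v) * Poly_Mapping.lookup p n when n - ?e = m) =
      (if n = m + ?e then of_nat (Poly_Mapping.lookup m v + 1) * Poly_Mapping.lookup p (m + ?e) else 0)"
    proof (cases "Poly_Mapping.lookup n v = 0")
      case True
      then have "n \<noteq> m + ?e" by (auto simp: lookup_add)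
      then show ?thesis using True by simp
    next
      case False
      from *[OF this] show ?thesis by (auto simp: lookup_add when_def)
    qed
  qed
  also have "\<dots> = of_nat (Poly_Mapping.lookup m v + 1) * Poly_Mapping.lookup p (m + ?e)"
    by (simp add: in_keys_iff)
  finally show ?thesis .
qed

lemma mp_deriv_diff: "mp_deriv v (p - q) = mp_deriv v p - mp_deriv v q"
  by (rule poly_mapping_eqI) (simp add: lookup_mp_deriv lookup_minus algebra_simps)

lemma lookup_free:
  assumes "p \<in> carrier (mp_ring V)" "v \<notin> V" "Poly_Mapping.lookup m v \<noteq> 0"
  shows "Poly_Mapping.lookup p m = 0"
  using assms unfolding mem_mp_ring by (metis in_keys_iff subset_iff)

lemma mp_deriv_free:
  fixes p :: "('v, 'a::comm_ring_1) mpoly"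
  assumes "p \<in> carrier (mp_ring V)" "v \<notin> V"
  shows "mp_deriv v p = 0"
proof (rule poly_mapping_eqI)
  fix m :: "'v \<Rightarrow>\<^sub>0 nat"
  have "Poly_Mapping.lookup p (m + Poly_Mapping.single v 1) = 0"
    by (rule lookup_free[OF assms]) (simp add: lookup_add)
  then show "Poly_Mapping.lookup (mp_deriv v p) m = Poly_Mapping.lookup 0 m"
    by (simp add: lookup_mp_deriv)
qed

lemma lookup_mult_monomial:
  fixes p :: "('v, 'a::comm_ring_1) mpoly"
  shows "Poly_Mapping.lookup (p * Poly_Mapping.single n 1) (m + n) = Poly_Mapping.lookup p m"
proof (induction p rule: update_induct)
  case (update p k c)
  have "Poly_Mapping.update k c p = Poly_Mapping.single k c + p"
    using update.hyps
    by (intro poly_mapping_eqI) (auto simp: lookup_update lookup_add lookup_single in_keys_iff)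
  then show ?case
    using update.IH by (simp add: distrib_right lookup_add mult_single lookup_single)
qed simp

lemma mp_deriv_linear:
  fixes p :: "('v, 'a::comm_ring_1) mpoly"
  assumes "p \<in> carrier (mp_ring V)" "v \<notin> V"
  shows "mp_deriv v (p * Var v) = p"
proof (rule poly_mapping_eqI)
  fix m :: "'v \<Rightarrow>\<^sub>0 nat"
  have "Poly_Mapping.lookup m v = 0 \<or> Poly_Mapping.lookup p m = 0"
    using lookup_free[OF assms] by blast
  then show "Poly_Mapping.lookup (mp_deriv v (p * Var v)) m = Poly_Mapping.lookup p m"
    unfolding lookup_mp_deriv Var_def lookup_mult_monomial by auto
qed

lemma list_comprehension_filter: "[f x. x \<leftarrow> xs, P x] = map f (filter P xs)"
  by (induction xs) auto

text \<open>
  The generators and the first \<open>d\<close> coordinates of the chart are indexed by the same list \<open>L\<close> of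
  the numbers \<open>j \<noteq> \<alpha> 0\<close>, so that the square of the Jacobian matrix to look at consists of all
  rows and the first \<open>d\<close> columns.
\<close>

lemma jacobian_submatrix:
  fixes q :: "nat \<Rightarrow> nat \<Rightarrow> 'a::field"
  assumes sum: "(\<Sum>r=1..d. r * e r) = d" and e0: "e 0 = d" and "\<alpha> 0 \<le> d"
  shows "submatrix (jacobian d e \<alpha> q) UNIV {..<d} =
    mp_eval (\<lambda>c. c) (affine_coords \<alpha> q) (theta d e \<alpha> (\<alpha> 0)) \<cdot>\<^sub>m 1\<^sub>m d"
proof -
  define L where "L = filter (\<lambda>j. j \<noteq> \<alpha> 0) [0..<Suc d]"
  have L: "distinct L" "set L = {..d} - {\<alpha> 0}"
    by (auto simp: L_def)
  have len: "length L = d"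
    using distinct_card[OF L(1)] L(2) \<open>\<alpha> 0 \<le> d\<close> by simp
  have gens: "generators d e \<alpha> = map (\<lambda>j. theta d e \<alpha> (\<alpha> 0) * Var (0, j) - theta d e \<alpha> j) L"
    unfolding generators_def L_def list_comprehension_filter ..
  obtain rest where vars: "chart_vars d e \<alpha> = map (\<lambda>j. (0, j)) L @ rest"
    unfolding chart_vars_def L_def list_comprehension_filter upt_conv_Cons[OF zero_less_Suc]
    by (simp add: e0 del: upt_Suc)
  have entry: "jacobian d e \<alpha> q $$ (i, k) =
     (if i = k then mp_eval (\<lambda>c. c) (affine_coords \<alpha> q) (theta d e \<alpha> (\<alpha> 0)) else 0)"
    if "i < d" "k < d" for i k
  proof -
    let ?W = "parameter_vars d e \<alpha>"
    let ?th = "theta d e \<alpha> :: nat \<Rightarrow> (nat \<times> nat, 'a) mpoly"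
    have z: "(0, j) \<notin> ?W" for j by (simp add: parameter_vars_def)
    have "L ! i \<le> d" using L(2) nth_mem[of i L] that len by auto
    note th = theta_parameter_vars[OF sum this, of \<alpha>] theta_parameter_vars[OF sum \<open>\<alpha> 0 \<le> d\<close>, of \<alpha>]
    have "?th (\<alpha> 0) * Var (0, L ! i) \<in> carrier (mp_ring (insert (0, L ! i) ?W))"
      using th(2) mp_ring_mono[of ?W "insert (0, L ! i) ?W"] by auto
    then have "mp_deriv (0, L ! k) (?th (\<alpha> 0) * Var (0, L ! i)) = 0" if "L ! k \<noteq> L ! i"
      using that z by (rule_tac mp_deriv_free) auto
    moreover have "L ! k = L ! i \<longleftrightarrow> i = k"
      using nth_eq_iff_index_eq[OF L(1)] that len by auto
    ultimately have deriv: "mp_deriv (0, L ! k) (?th (\<alpha> 0) * Var (0, L ! i) - ?th (L ! i)) =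
        (if i = k then ?th (\<alpha> 0) else 0)"
      using mp_deriv_free[OF th(1) z] mp_deriv_linear[OF th(2) z] by (auto simp: mp_deriv_diff)
    have "jacobian d e \<alpha> q $$ (i, k) = mp_eval (\<lambda>c. c) (affine_coords \<alpha> q)
       (mp_deriv (0, L ! k) (theta d e \<alpha> (\<alpha> 0) * Var (0, L ! i) - theta d e \<alpha> (L ! i)))"
      using that by (simp add: jacobian_def gens vars len nth_append)
    then show ?thesis
      unfolding deriv by (simp add: mp_eval_def)
  qed
  have dims: "dim_row (jacobian d e \<alpha> q) = d" "d \<le> dim_col (jacobian d e \<alpha> q)"
    by (simp_all add: jacobian_def gens vars len)
  have rows: "{i. i < dim_row (jacobian d e \<alpha> q) \<and> i \<in> UNIV} = {..<d}"
    and cols: "{k. k < dim_col (jacobian d e \<alpha> q) \<and> k \<in> {..<d}} = {..<d}"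
    using dims by auto
  have pick: "pick {..<d} k = k" if "k < d" for k
    using pick_reduce_set[of k d UNIV] that by (simp add: pick_UNIV lessThan_def)
  show ?thesis
  proof (rule eq_matI)
    fix i k assume "i < dim_row (mp_eval (\<lambda>c. c) (affine_coords \<alpha> q) (theta d e \<alpha> (\<alpha> 0)) \<cdot>\<^sub>m 1\<^sub>m d)"
      "k < dim_col (mp_eval (\<lambda>c. c) (affine_coords \<alpha> q) (theta d e \<alpha> (\<alpha> 0)) \<cdot>\<^sub>m 1\<^sub>m d)"
    then have ik: "i < d" "k < d" by simp_all
    have "submatrix (jacobian d e \<alpha> q) UNIV {..<d} $$ (i, k) = jacobian d e \<alpha> q $$ (pick UNIV i, pick {..<d} k)"
      by (rule submatrix_index) (simp_all only: rows cols, simp_all add: ik)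
    then show "submatrix (jacobian d e \<alpha> q) UNIV {..<d} $$ (i, k) =
      (mp_eval (\<lambda>c. c) (affine_coords \<alpha> q) (theta d e \<alpha> (\<alpha> 0)) \<cdot>\<^sub>m 1\<^sub>m d) $$ (i, k)"
      using ik by (simp add: pick_UNIV pick entry)
  qed (simp_all only: dim_submatrix rows cols, simp_all)
qed

section \<open>Lifting homomorphisms\<close>

lemma carrier_Quot: "carrier (R Quot I) = (\<lambda>x. I +>\<^bsub>R\<^esub> x) ` carrier R"
  by (auto simp: FactRing_def A_RCOSETS_def')

lemma hom_factors_through_quotient:
  assumes h: "h \<in> Ring.ring_hom R C" and I: "ideal I R" and "ring C"
    and zero: "\<And>x. x \<in> I \<Longrightarrow> h x = \<zero>\<^bsub>C\<^esub>"
  shows "\<exists>k\<in>Ring.ring_hom (R Quot I) C. \<forall>x\<in>carrier R. k (I +>\<^bsub>R\<^esub> x) = h x"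
proof -
  define k where "k = (\<lambda>A. the_elem (h ` A))"
  interpret I: ideal I R by fact
  interpret C: ring C by fact
  interpret h: ring_hom_ring R C h
    by (rule ring_hom_ringI2[OF I.ring_axioms \<open>ring C\<close> h])
  have k: "k (I +>\<^bsub>R\<^esub> x) = h x" if x: "x \<in> carrier R" for x
  proof -
    have "h (i \<oplus>\<^bsub>R\<^esub> x) = h x" if "i \<in> I" for i
      using x zero[OF that] I.Icarr[OF that] by simp
    moreover have "I \<noteq> {}" using additive_subgroup.zero_closed[OF I.additive_subgroup_axioms] by blast
    moreover have "I +>\<^bsub>R\<^esub> x = (\<lambda>i. i \<oplus>\<^bsub>R\<^esub> x) ` I"
      by (auto simp: a_r_coset_def')
    ultimately have "h ` (I +>\<^bsub>R\<^esub> x) = {h x}"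
      by (simp add: image_image image_constant_conv)
    then show ?thesis by (simp add: k_def)
  qed
  have "k \<in> Ring.ring_hom (R Quot I) C"
  proof (rule ring_hom_memI)
    fix A assume "A \<in> carrier (R Quot I)"
    then obtain x where x: "x \<in> carrier R" "A = I +>\<^bsub>R\<^esub> x" by (auto simp: carrier_Quot)
    then show "k A \<in> carrier C" by (simp add: k)
    fix B assume "B \<in> carrier (R Quot I)"
    then obtain y where y: "y \<in> carrier R" "B = I +>\<^bsub>R\<^esub> y" by (auto simp: carrier_Quot)
    have "A \<otimes>\<^bsub>R Quot I\<^esub> B = I +>\<^bsub>R\<^esub> (x \<otimes>\<^bsub>R\<^esub> y)" "A \<oplus>\<^bsub>R Quot I\<^esub> B = I +>\<^bsub>R\<^esub> (x \<oplus>\<^bsub>R\<^esub> y)"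
      using ring_hom_mult[OF I.rcos_ring_hom x(1) y(1)] ring_hom_add[OF I.rcos_ring_hom x(1) y(1)] x(2) y(2)
      by simp_all
    then show "k (A \<otimes>\<^bsub>R Quot I\<^esub> B) = k A \<otimes>\<^bsub>C\<^esub> k B" "k (A \<oplus>\<^bsub>R Quot I\<^esub> B) = k A \<oplus>\<^bsub>C\<^esub> k B"
      using x y by (simp_all add: k)
  next
    show "k \<one>\<^bsub>R Quot I\<^esub> = \<one>\<^bsub>C\<^esub>"
      using ring_hom_one[OF I.rcos_ring_hom] k[of "\<one>\<^bsub>R\<^esub>"] by simp
  qed
  with k show ?thesis by blast
qed

text \<open>
  If \<open>a c = 1 + n\<close> with \<open>n\<^sup>2 = 0\<close>, then \<open>a (1 - n)\<close> is an inverse of \<open>c\<close>.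
\<close>

lemma (in cring) unit_lifts_along_square_zero_ideal:
  assumes N: "ideal N R" "\<And>x y. x \<in> N \<Longrightarrow> y \<in> N \<Longrightarrow> x \<otimes> y = \<zero>"
    and "a \<in> carrier R" "c \<in> carrier R" "N +> (a \<otimes> c) = N +> \<one>"
  shows "\<exists>c'\<in>carrier R. c \<otimes> c' = \<one>"
proof -
  define n where "n = a \<otimes> c \<ominus> \<one>"
  have "n \<in> N"
    unfolding n_def using assms quotient_eq_iff_same_a_r_cos[OF N(1)] by simp
  then have nn: "n \<otimes> n = \<zero>" and n: "n \<in> carrier R" using N ideal.Icarr by fast+
  have "a \<otimes> c = \<one> \<oplus> n"
    unfolding n_def using assms by algebra
  then have "c \<otimes> (a \<otimes> (\<one> \<ominus> n)) = (\<one> \<oplus> n) \<otimes> (\<one> \<ominus> n)"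
    using assms n by (simp add: m_assoc[symmetric] m_comm[of c a])
  also have "\<dots> = \<one> \<ominus> n \<otimes> n"
    using n by algebra
  also have "\<dots> = \<one>" using nn by (simp add: a_minus_def)
  finally show ?thesis using assms n by blast
qed

section \<open>Smoothness\<close>

text \<open>
  Modulo \<open>T_phi\<close>, each \<open>\<theta>\<^sub>j\<close> is the product of \<open>z\<^sub>j\<close> and the \<open>\<theta>\<close> with index \<open>\<alpha> 0\<close>.  So the ideal
  \<open>J\<close> that is generated by \<open>T_phi\<close> and this \<open>\<theta>\<close> contains all coefficients of a product of
  polynomials that have a coefficient 1, and such an ideal is the whole ring.
\<close>

lemma theta_unit_modulo_T_phi:
  assumes sum: "(\<Sum>r=1..d. r * e r) = d" and e0: "e 0 = d" and \<alpha>: "\<alpha> \<in> chart_indices d e"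
  shows "\<exists>a\<in>carrier (chart_ring d e \<alpha>).
    1 - a * theta d e \<alpha> (\<alpha> 0) \<in> (T_phi d e \<alpha> :: (nat \<times> nat, 'a::field) mpoly set)"
proof -
  let ?R = "chart_ring d e \<alpha> :: (nat \<times> nat, 'a) mpoly ring"
  let ?I = "T_phi d e \<alpha> :: (nat \<times> nat, 'a) mpoly set"
  let ?th = "theta d e \<alpha> :: nat \<Rightarrow> (nat \<times> nat, 'a) mpoly"
  interpret R: cring ?R by (rule chart_ring_cring)
  have \<alpha>0: "\<alpha> 0 \<le> d" and \<alpha>r: "\<And>r. r \<in> {1..d} \<Longrightarrow> \<alpha> r \<le> e r"
    using \<alpha> e0 by (auto simp: chart_indices_def PiE_iff)
  have th: "?th (\<alpha> 0) \<in> carrier ?R" by (rule theta_chart_ring[OF sum \<alpha>0])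
  define J where "J = ?I <+>\<^bsub>?R\<^esub> PIdl\<^bsub>?R\<^esub> (?th (\<alpha> 0))"
  have "ideal J ?R"
    unfolding J_def by (intro R.add_ideals T_phi_ideal[OF sum e0] R.cgenideal_ideal th)
  then have J: "ideal J (ring_of_type_algebra\<lparr>carrier := carrier ?R\<rparr>)"
    by (simp add: chart_ring_def mp_ring_def)
  have mem_J: "x \<in> J \<longleftrightarrow> (\<exists>i\<in>?I. \<exists>a\<in>carrier ?R. x = i + a * ?th (\<alpha> 0))" for x
    by (auto simp: J_def set_add_def' cgenideal_def)
  have theta_J: "?th j \<in> J" if "j \<le> d" for j
  proof -
    have "?th j - ?th (\<alpha> 0) * normalized_var \<alpha> (0, j) \<in> ?I"
      using minor_mem_T_phi[OF sum e0 that \<alpha>0, of \<alpha>] by (simp add: normalized_var_def)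
    then show ?thesis
      unfolding mem_J using normalized_var_chart_ring[of e d j \<alpha>, OF e0 that]
      by (force simp: algebra_simps)
  qed
  have "1 \<in> J"
  proof (rule unit_ideal_if_coeffs_of_product[OF J, of "{1..d}"])
    fix r i assume r: "r \<in> {1..d}"
    show "Polynomial.coeff (\<Sum>t\<le>e r. Polynomial.monom (normalized_var \<alpha> (r, t)) t) i \<in> carrier ?R"
      using r by (auto simp: coeff_sum_monom normalized_var_def chart_ring_def set_chart_vars)
    show "\<exists>t. Polynomial.coeff (\<Sum>t\<le>e r. Polynomial.monom (normalized_var \<alpha> (r, t)) t) t = (1 :: (nat \<times> nat, 'a) mpoly)"
      using \<alpha>r[OF r] by (intro exI[of _ "\<alpha> r"]) (simp add: coeff_sum_monom normalized_var_def)
  next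
    fix i
    have "Polynomial.coeff (dehomogenized_product d e (normalized_var \<alpha>)) i \<in> J"
    proof (cases "i \<le> d")
      case True
      from theta_J[OF this] show ?thesis unfolding theta_eq_coeff[OF sum True] .
    next
      case False
      then show ?thesis
        using subring_ideal_facts(1)[OF J] by (simp add: coeff_dehomogenized_product[OF sum])
    qed
    then show "Polynomial.coeff (\<Prod>r=1..d. (\<Sum>t\<le>e r. Polynomial.monom (normalized_var \<alpha> (r, t)) t) ^ r) i \<in> J"
      by (simp add: dehomogenized_product_def)
  qed simp
  then obtain i a where "i \<in> ?I" "a \<in> carrier ?R" "1 = i + a * ?th (\<alpha> 0)"
    unfolding mem_J by blast
  then show ?thesis by (intro bexI[of _ a]) (simp_all add: eq_diff_eq[symmetric])
qed

text \<open>
  The map \<open>E0\<close> lifts the given homomorphism on the polynomial ring, with arbitrary lifts of the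
  values of the variables; it need not respect \<open>T_phi\<close>.  The map \<open>E\<close> has the same values
  on the \<open>w\<close>, hence on the \<open>\<theta>\<^sub>j\<close>, but sends each \<open>z\<^sub>j\<close> to the quotient of \<open>\<theta>\<^sub>j\<close> by the \<open>\<theta>\<close> with
  index \<open>\<alpha> 0\<close>.  Then the minors go to zero, and \<open>E\<close> still lifts the given homomorphism \<open>g\<close>, since
  \<open>g\<close> respects the equations that determine the \<open>z\<^sub>j\<close>.
\<close>

lemma formally_smooth_T_phi:
  assumes sum: "(\<Sum>r=1..d. r * e r) = d" and e0: "e 0 = d" and \<alpha>: "\<alpha> \<in> chart_indices d e"
  shows "formally_smooth TYPE('c)
    (\<lambda>c. (T_phi d e \<alpha> :: (nat \<times> nat, 'a::field) mpoly set) +>\<^bsub>chart_ring d e \<alpha>\<^esub> Const c)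
    (chart_ring d e \<alpha> Quot T_phi d e \<alpha>)"
  unfolding formally_smooth_def
proof (intro allI impI, elim conjE)
  let ?R = "chart_ring d e \<alpha> :: (nat \<times> nat, 'a) mpoly ring"
  let ?I = "T_phi d e \<alpha> :: (nat \<times> nat, 'a) mpoly set"
  let ?th = "theta d e \<alpha> :: nat \<Rightarrow> (nat \<times> nat, 'a) mpoly"
  let ?z = "\<lambda>j. normalized_var \<alpha> (0, j) :: (nat \<times> nat, 'a) mpoly"
  let ?V = "set (chart_vars d e \<alpha>)"
  fix C :: "'c ring" and N u g
  assume C: "cring C" and N: "ideal N C" and square_zero: "\<forall>x\<in>N. \<forall>y\<in>N. x \<otimes>\<^bsub>C\<^esub> y = \<zero>\<^bsub>C\<^esub>"
    and u: "u \<in> Ring.ring_hom ring_of_type_algebra C"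
    and g: "g \<in> Ring.ring_hom (?R Quot ?I) (C Quot N)"
    and gu: "\<forall>c. g (?I +>\<^bsub>?R\<^esub> Const c) = N +>\<^bsub>C\<^esub> u c"
  interpret C: cring C by fact
  interpret N: ideal N C by fact
  interpret Q: cring "C Quot N" by (rule N.quotient_is_cring[OF C])
  interpret R: cring ?R by (rule chart_ring_cring)
  interpret I: ideal ?I ?R by (rule T_phi_ideal[OF sum e0])
  define pr where "pr x = N +>\<^bsub>C\<^esub> x" for x
  have pr: "pr \<in> Ring.ring_hom C (C Quot N)"
    using N.rcos_ring_hom by (simp add: pr_def[abs_def])
  interpret pr: ring_hom_cring C "C Quot N" pr
    by (intro ring_hom_cringI ring_hom_ringI2 pr C C.ring_axioms Q.ring_axioms Q.is_cring)
  define G where "G p = g (?I +>\<^bsub>?R\<^esub> p)" for p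
  have G: "G \<in> Ring.ring_hom ?R (C Quot N)"
    using ring_hom_trans[OF I.rcos_ring_hom g] by (simp add: G_def[abs_def] comp_def)
  have pr_Const: "pr (u c) = G (Const c)" for c
    using gu by (simp add: G_def pr_def)
  interpret G: ring_hom_cring ?R "C Quot N" G
    by (intro ring_hom_cringI ring_hom_ringI2 G R.ring_axioms R.is_cring Q.ring_axioms Q.is_cring)
  have G_I: "G p = \<zero>\<^bsub>C Quot N\<^esub>" if "p \<in> ?I" for p
  proof -
    interpret g: ring_hom_ring "?R Quot ?I" "C Quot N" g
      by (intro ring_hom_ringI2 I.quotient_is_ring Q.ring_axioms g)
    show ?thesis
      using R.a_rcos_zero[OF I.is_ideal that] g.hom_zero by (simp add: G_def FactRing_def)
  qed
  have \<alpha>0: "\<alpha> 0 \<le> d"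
    using \<alpha> e0 by (auto simp: chart_indices_def PiE_iff)
  have th [simp]: "?th j \<in> carrier ?R" if "j \<le> d" for j by (rule theta_chart_ring[OF sum that])
  have z [simp]: "?z j \<in> carrier ?R" if "j \<le> d" for j by (rule normalized_var_chart_ring[of e, OF e0 that])

  have "\<exists>x. x \<in> carrier C \<and> (v \<in> ?V \<longrightarrow> pr x = G (Var v))" for v
  proof (cases "v \<in> ?V")
    case True
    then have "G (Var v) \<in> carrier (C Quot N)" by (intro G.hom_closed) (auto simp: chart_ring_def)
    then obtain x where "x \<in> carrier C" "G (Var v) = N +>\<^bsub>C\<^esub> x" by (auto simp: carrier_Quot)
    then show ?thesis by (intro exI[of _ x]) (simp add: pr_def)
  qed auto
  then obtain \<sigma>0 where \<sigma>0: "\<And>v. \<sigma>0 v \<in> carrier C" "\<And>v. v \<in> ?V \<Longrightarrow> pr (\<sigma>0 v) = G (Var v)"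
    by metis
  interpret E0: mpoly_evaluation C u \<sigma>0
    by (intro mpoly_evaluation.intro mpoly_evaluation_axioms.intro C u \<sigma>0)
  have pr_E0: "pr (E0.evaluate p) = G p" if "p \<in> carrier ?R" for p
  proof -
    have "(pr \<circ> E0.evaluate) p = G p"
    proof (rule mpoly_hom_eqI[of _ ?V])
      show "pr \<circ> E0.evaluate \<in> Ring.ring_hom (mp_ring ?V) (C Quot N)"
        by (rule ring_hom_trans[OF E0.evaluate_hom_mp_ring pr])
      show "G \<in> Ring.ring_hom (mp_ring ?V) (C Quot N)" using G by (simp add: chart_ring_def)
      show "p \<in> carrier (mp_ring ?V)" using that by (simp add: chart_ring_def)
    qed (simp_all add: E0.evaluate_Const E0.evaluate_Var \<sigma>0(2) pr_Const)
    then show ?thesis by simp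
  qed

  obtain a where a: "a \<in> carrier ?R" "1 - a * ?th (\<alpha> 0) \<in> ?I"
    using theta_unit_modulo_T_phi[OF sum e0 \<alpha>, where ?'a = 'a] by blast
  have a_th: "a * ?th (\<alpha> 0) \<in> carrier ?R"
    using R.m_closed[OF a(1) th[OF \<alpha>0]] by simp
  have G1: "G (1 - a * ?th (\<alpha> 0)) \<oplus>\<^bsub>C Quot N\<^esub> G (a * ?th (\<alpha> 0)) = \<one>\<^bsub>C Quot N\<^esub>"
    using G.hom_add[OF I.Icarr[OF a(2)] a_th] G.hom_one by simp
  then have G_a_th: "G (a * ?th (\<alpha> 0)) = \<one>\<^bsub>C Quot N\<^esub>"
    using G_I[OF a(2)] G.hom_closed[OF a_th] by simp
  have "pr (E0.evaluate a \<otimes>\<^bsub>C\<^esub> E0.evaluate (?th (\<alpha> 0))) = pr \<one>\<^bsub>C\<^esub>"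
    using pr_E0[OF a_th] G_a_th by (simp only: E0.evaluate_mult pr.hom_one)
  then obtain c where c: "c \<in> carrier C" "E0.evaluate (?th (\<alpha> 0)) \<otimes>\<^bsub>C\<^esub> c = \<one>\<^bsub>C\<^esub>"
    using C.unit_lifts_along_square_zero_ideal[OF N _ E0.evaluate_closed[of a] E0.evaluate_closed[of "?th (\<alpha> 0)"]]
      square_zero unfolding pr_def by blast

  \<comment> \<open>The values of the \<open>z\<^sub>j\<close> are replaced by the quotients that the minors force upon them.\<close>
  define \<sigma> where "\<sigma> v = (if fst v = 0 then E0.evaluate (?th (snd v)) \<otimes>\<^bsub>C\<^esub> c else \<sigma>0 v)" for v
  have \<sigma>: "\<sigma> v \<in> carrier C" for v using \<sigma>0(1) c(1) by (simp add: \<sigma>_def)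
  interpret E: mpoly_evaluation C u \<sigma>
    by (intro mpoly_evaluation.intro mpoly_evaluation_axioms.intro C u \<sigma>)
  have E_th: "E.evaluate (?th j) = E0.evaluate (?th j)" if "j \<le> d" for j
    using E.evaluate_hom_mp_ring E0.evaluate_hom_mp_ring
  proof (rule mpoly_hom_eqI)
    show "?th j \<in> carrier (mp_ring (parameter_vars d e \<alpha>))" by (rule theta_parameter_vars[OF sum that])
  qed (auto simp: E.evaluate_Const E0.evaluate_Const E.evaluate_Var E0.evaluate_Var \<sigma>_def parameter_vars_def)
  have E_one: "E.evaluate 1 = \<one>\<^bsub>C\<^esub>"
    using ring_hom_one[OF E.evaluate_hom] by simp
  have E_z: "E.evaluate (?z j) = E0.evaluate (?th j) \<otimes>\<^bsub>C\<^esub> c" for j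
    by (simp add: normalized_var_def E_one c(2) E.evaluate_Var \<sigma>_def)

  interpret ER: ring_hom_cring ?R C E.evaluate
    using E.evaluate_hom_mp_ring[of ?V] unfolding chart_ring_def[symmetric]
    by (intro ring_hom_cringI ring_hom_ringI2 R.ring_axioms R.is_cring C.ring_axioms C)
  have "minors 2 (phi_mat d e \<alpha>) \<subseteq> a_kernel ?R C E.evaluate"
  proof
    fix m :: "(nat \<times> nat, 'a) mpoly" assume m: "m \<in> minors 2 (phi_mat d e \<alpha>)"
    then obtain i j where "i < j" "j \<le> d" "m = ?th i * ?z j - ?th j * ?z i"
      unfolding minors_phi_mat by blast
    then have ij: "i \<le> d" "j \<le> d" and m_eq: "m + ?th j * ?z i = ?th i * ?z j"
      by simp_all
    have "E.evaluate m \<oplus>\<^bsub>C\<^esub> E.evaluate (?th j) \<otimes>\<^bsub>C\<^esub> E.evaluate (?z i)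
        = E.evaluate (?th i) \<otimes>\<^bsub>C\<^esub> E.evaluate (?z j)"
      using arg_cong[OF m_eq, of E.evaluate] by (simp only: E.evaluate_add E.evaluate_mult)
    moreover have "E.evaluate (?th i) \<otimes>\<^bsub>C\<^esub> E.evaluate (?z j) = E.evaluate (?th j) \<otimes>\<^bsub>C\<^esub> E.evaluate (?z i)"
      using c(1) by (simp add: E_z E_th ij C.m_lcomm)
    ultimately have "E.evaluate m = \<zero>\<^bsub>C\<^esub>"
      by (simp only: C.add.r_cancel_one[OF C.m_closed[OF E.evaluate_closed E.evaluate_closed] E.evaluate_closed])
    with subsetD[OF minors_chart_ring[OF sum e0] m] show "m \<in> a_kernel ?R C E.evaluate"
      unfolding a_kernel_def' by blast
  qed
  then have "?I \<subseteq> a_kernel ?R C E.evaluate"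
    unfolding T_phi_def by (rule R.genideal_minimal[OF ER.ring.kernel_is_ideal])
  then obtain h where h: "h \<in> Ring.ring_hom (?R Quot ?I) C"
    and h_eq: "\<And>p. p \<in> carrier ?R \<Longrightarrow> h (?I +>\<^bsub>?R\<^esub> p) = E.evaluate p"
    using hom_factors_through_quotient[OF ER.homh I.is_ideal C.ring_axioms] unfolding a_kernel_def' by blast

  have pr_E: "pr (E.evaluate p) = G p" if "p \<in> carrier ?R" for p
  proof -
    have pr_Var: "pr (E.evaluate (Var v)) = G (Var v)" if v: "v \<in> ?V" for v
    proof (cases "fst v = 0")
      case False
      then show ?thesis using \<sigma>0(2)[OF v] by (simp add: E.evaluate_Var \<sigma>_def)
    next
      case True
      then obtain j where v_eq: "v = (0, j)" and j: "j \<le> d" "j \<noteq> \<alpha> 0"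
        using v e0 by (cases v) (auto simp: set_chart_vars)
      have z_j: "?z j = Var v" using j by (simp add: normalized_var_def v_eq)
      have minor: "?th (\<alpha> 0) * ?z j - ?th j \<in> ?I"
        using minor_mem_T_phi[OF sum e0 \<alpha>0 j(1), of \<alpha>] by (simp add: normalized_var_def)
      have "G (?th (\<alpha> 0)) \<otimes>\<^bsub>C Quot N\<^esub> G (?z j) = G (?th (\<alpha> 0) * ?z j - ?th j) \<oplus>\<^bsub>C Quot N\<^esub> G (?th j)"
        using G.hom_mult[OF th[OF \<alpha>0] z[OF j(1)]] G.hom_add[OF I.Icarr[OF minor] th[OF j(1)]] by simp
      then have G_z: "G (?th j) = G (?th (\<alpha> 0)) \<otimes>\<^bsub>C Quot N\<^esub> G (?z j)"
        using G_I[OF minor] G.hom_closed[OF th[OF j(1)]] by simp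
      have "pr c \<otimes>\<^bsub>C Quot N\<^esub> G (?th (\<alpha> 0)) = \<one>\<^bsub>C Quot N\<^esub>"
        using arg_cong[OF c(2), of pr] c(1) \<alpha>0 by (simp add: pr_E0 Q.m_comm)
      moreover have "pr (E.evaluate (?z j)) = (pr c \<otimes>\<^bsub>C Quot N\<^esub> G (?th (\<alpha> 0))) \<otimes>\<^bsub>C Quot N\<^esub> G (?z j)"
        using c(1) \<alpha>0 j(1) by (simp add: E_z pr_E0 G_z Q.m_ac)
      ultimately show ?thesis using j(1) by (simp add: z_j[symmetric])
    qed
    have "(pr \<circ> E.evaluate) p = G p"
    proof (rule mpoly_hom_eqI[of _ ?V])
      show "pr \<circ> E.evaluate \<in> Ring.ring_hom (mp_ring ?V) (C Quot N)"
        by (rule ring_hom_trans[OF E.evaluate_hom_mp_ring pr])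
      show "G \<in> Ring.ring_hom (mp_ring ?V) (C Quot N)" using G by (simp add: chart_ring_def)
      show "p \<in> carrier (mp_ring ?V)" using that by (simp add: chart_ring_def)
    qed (simp_all add: E.evaluate_Const pr_Const pr_Var)
    then show ?thesis by simp
  qed

  show "\<exists>h\<in>Ring.ring_hom (?R Quot ?I) C. (\<forall>c. h (?I +>\<^bsub>?R\<^esub> Const c) = u c) \<and>
     (\<forall>x\<in>carrier (?R Quot ?I). N +>\<^bsub>C\<^esub> h x = g x)"
  proof (intro bexI[OF _ h] conjI allI ballI)
    show "h (?I +>\<^bsub>?R\<^esub> Const c) = u c" for c
      by (subst h_eq) (auto simp: chart_ring_def E.evaluate_Const)
    fix x assume "x \<in> carrier (?R Quot ?I)"
    then obtain p where "p \<in> carrier ?R" "x = ?I +>\<^bsub>?R\<^esub> p" by (auto simp: carrier_Quot)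
    then show "N +>\<^bsub>C\<^esub> h x = g x" using pr_E[of p] by (simp add: h_eq pr_def G_def)
  qed
qed

text \<open>
  Finite presentation is defined with the variables \<open>0, \<dots>, n - 1\<close>; the renaming \<open>\<rho>\<close> of the
  variables, with inverse \<open>\<tau>\<close>, transports a presentation by other variables.
\<close>

lemma finitely_presented_quotient:
  fixes M :: "('v, 'a::field) mpoly set"
  assumes "distinct vs" and M: "finite M" "M \<subseteq> carrier (mp_ring (set vs))"
  shows "finitely_presented (\<lambda>c. (Idl\<^bsub>mp_ring (set vs)\<^esub> M) +>\<^bsub>mp_ring (set vs)\<^esub> Const c)
    (mp_ring (set vs) Quot (Idl\<^bsub>mp_ring (set vs)\<^esub> M))"
proof -
  define n where "n = length vs"
  let ?R = "mp_ring (set vs) :: ('v, 'a) mpoly ring"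
  let ?P = "mp_ring {..<n} :: (nat, 'a) mpoly ring"
  define I where "I = Idl\<^bsub>?R\<^esub> M"
  interpret R: cring ?R by (rule mp_ring_cring)
  interpret P: cring ?P by (rule mp_ring_cring)
  interpret I: ideal I ?R unfolding I_def by (rule R.genideal_ideal[OF M(2)])
  define idx where "idx = inv_into {..<n} ((!) vs)"
  have bij: "bij_betw ((!) vs) {..<n} (set vs)"
    unfolding n_def by (rule bij_betw_nth[OF assms(1)]) auto
  have idx: "idx (vs ! i) = i" if "i < n" for i
    unfolding idx_def using that bij by (simp add: bij_betw_def inv_into_f_f)
  have idx': "idx v < n" "vs ! idx v = v" if "v \<in> set vs" for v
    using bij_betw_inv_into_right[OF bij that] bij_betw_apply[OF bij_betw_inv_into[OF bij] that]
    by (simp_all add: idx_def)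
  define \<rho> :: "(nat, 'a) mpoly \<Rightarrow> ('v, 'a) mpoly" where "\<rho> = mp_eval Const (\<lambda>i. Var (vs ! i))"
  define \<tau> :: "('v, 'a) mpoly \<Rightarrow> (nat, 'a) mpoly" where "\<tau> = mp_eval Const (\<lambda>v. Var (idx v))"
  note \<rho>_simps = mp_eval_hom(2,3,5,7)[where \<sigma> = "(\<lambda>i. Var (vs ! i)) :: nat \<Rightarrow> ('v, 'a) mpoly", OF Const_hom, folded \<rho>_def]
  note \<tau>_simps = mp_eval_hom(2,3,5,7)[where \<sigma> = "(\<lambda>v. Var (idx v)) :: 'v \<Rightarrow> (nat, 'a) mpoly", OF Const_hom, folded \<tau>_def]
  have \<rho>_R: "\<rho> p \<in> carrier ?R" if "p \<in> carrier ?P" for p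
    using that by (induction p rule: mp_ring_induct) (auto simp: \<rho>_simps n_def)
  have \<tau>_P: "\<tau> p \<in> carrier ?P" if "p \<in> carrier ?R" for p
    using that by (induction p rule: mp_ring_induct) (auto simp: \<tau>_simps idx')
  have \<tau>\<rho>: "\<tau> (\<rho> p) = p" if "p \<in> carrier ?P" for p
    using that by (induction p rule: mp_ring_induct) (auto simp: \<tau>_simps \<rho>_simps idx)
  have \<rho>\<tau>: "\<rho> (\<tau> p) = p" if "p \<in> carrier ?R" for p
    using that by (induction p rule: mp_ring_induct) (auto simp: \<tau>_simps \<rho>_simps idx')
  have \<rho>: "\<rho> \<in> Ring.ring_hom ?P ?R"
    using \<rho>_R \<rho>_simps(1)[of 1] by (intro ring_hom_memI) (auto simp: \<rho>_simps Const_def)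
  have \<tau>: "\<tau> \<in> Ring.ring_hom ?R ?P"
    using \<tau>_P \<tau>_simps(1)[of 1] by (intro ring_hom_memI) (auto simp: \<tau>_simps Const_def)
  interpret \<rho>: ring_hom_ring ?P ?R \<rho> by (intro ring_hom_ringI2 P.ring_axioms R.ring_axioms \<rho>)
  interpret \<tau>: ring_hom_ring ?R ?P \<tau> by (intro ring_hom_ringI2 P.ring_axioms R.ring_axioms \<tau>)
  define \<pi> where "\<pi> p = I +>\<^bsub>?R\<^esub> \<rho> p" for p
  have \<pi>: "\<pi> \<in> Ring.ring_hom ?P (?R Quot I)"
    using ring_hom_trans[OF \<rho> I.rcos_ring_hom] by (simp add: \<pi>_def[abs_def] comp_def)
  have image: "\<pi> ` carrier ?P = carrier (?R Quot I)"
  proof -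
    have "\<rho> ` carrier ?P = carrier ?R"
    proof
      show "carrier ?R \<subseteq> \<rho> ` carrier ?P"
        using \<rho>\<tau> \<tau>_P by (metis image_eqI subsetI)
    qed (use \<rho>_R in auto)
    then show ?thesis unfolding carrier_Quot \<pi>_def by (metis image_image)
  qed
  have kernel: "a_kernel ?P (?R Quot I) \<pi> = {p \<in> carrier ?P. \<rho> p \<in> I}"
  proof -
    have "\<pi> p = I \<longleftrightarrow> \<rho> p \<in> I" if "p \<in> carrier ?P" for p
      using I.rcos_const_imp_mem[OF \<rho>_R[OF that]] R.a_rcos_zero[OF I.is_ideal, of "\<rho> p"]
      unfolding \<pi>_def by blast
    moreover have "\<zero>\<^bsub>?R Quot I\<^esub> = I" by (simp add: FactRing_def)
    ultimately show ?thesis unfolding a_kernel_def' by blast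
  qed
  have M_I: "M \<subseteq> I" unfolding I_def by (rule R.genideal_self[OF M(2)])
  have \<tau>M: "\<tau> ` M \<subseteq> carrier ?P" using M(2) \<tau>_P by auto
  have "{p \<in> carrier ?P. \<rho> p \<in> I} = Idl\<^bsub>?P\<^esub> (\<tau> ` M)"
  proof
    show "Idl\<^bsub>?P\<^esub> (\<tau> ` M) \<subseteq> {p \<in> carrier ?P. \<rho> p \<in> I}"
      using \<tau>M M_I M(2) \<rho>\<tau> by (intro P.genideal_minimal \<rho>.ideal_vimage[OF I.is_ideal]) auto
    have "I \<subseteq> {p \<in> carrier ?R. \<tau> p \<in> Idl\<^bsub>?P\<^esub> (\<tau> ` M)}"
      unfolding I_def using M(2) P.genideal_self[OF \<tau>M]
      by (intro R.genideal_minimal \<tau>.ideal_vimage P.genideal_ideal \<tau>M) auto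
    then show "{p \<in> carrier ?P. \<rho> p \<in> I} \<subseteq> Idl\<^bsub>?P\<^esub> (\<tau> ` M)"
      using \<tau>\<rho> by force
  qed
  then have "finite (\<tau> ` M) \<and> \<tau> ` M \<subseteq> carrier ?P \<and> \<pi> \<in> Ring.ring_hom ?P (?R Quot I) \<and>
     \<pi> ` carrier ?P = carrier (?R Quot I) \<and> a_kernel ?P (?R Quot I) \<pi> = Idl\<^bsub>?P\<^esub> (\<tau> ` M) \<and>
     (\<forall>c. \<pi> (Const c) = I +>\<^bsub>?R\<^esub> Const c)"
    using M(1) \<tau>M \<pi> image kernel by (simp add: \<pi>_def \<rho>_simps)
  then show ?thesis
    unfolding finitely_presented_def Let_def I_def[symmetric]
    by - (rule exI[of _ n], rule exI[of _ "\<tau> ` M"], rule exI[of _ \<pi>], assumption)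
qed

lemma distinct_chart_vars: "distinct (chart_vars d e \<alpha>)"
proof -
  have "distinct (concat (map (\<lambda>r. map (Pair r) (filter (\<lambda>t. t \<noteq> \<alpha> r) [0..<Suc (e r)])) rs))" if "distinct rs" for rs
    using that by (induction rs) (auto simp: distinct_map inj_on_def simp del: upt_Suc)
  then show ?thesis
    unfolding chart_vars_def list_comprehension_filter by (simp del: upt_Suc)
qed

lemma smooth_T_phi:
  assumes sum: "(\<Sum>r=1..d. r * e r) = d" and e0: "e 0 = d"
  shows "smooth_subscheme TYPE('c) d e (T_phi d e :: (nat \<Rightarrow> nat) \<Rightarrow> (nat \<times> nat, 'a::field) mpoly set)"
  unfolding smooth_subscheme_def
proof
  fix \<alpha> assume \<alpha>: "\<alpha> \<in> chart_indices d e"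
  let ?R = "chart_ring d e \<alpha> :: (nat \<times> nat, 'a) mpoly ring"
  let ?I = "T_phi d e \<alpha> :: (nat \<times> nat, 'a) mpoly set"
  let ?M = "minors 2 (phi_mat d e \<alpha>) :: (nat \<times> nat, 'a) mpoly set"
  interpret I: ideal ?I ?R by (rule T_phi_ideal[OF sum e0])
  have "?M \<subseteq> (\<lambda>(i, j). theta d e \<alpha> i * normalized_var \<alpha> (0, j) - theta d e \<alpha> j * normalized_var \<alpha> (0, i)) ` ({..d} \<times> {..d})"
    unfolding minors_phi_mat by force
  then have "finite ?M" by (rule finite_subset) simp
  then have "finitely_presented (\<lambda>c. ?I +>\<^bsub>?R\<^esub> Const c) (?R Quot ?I)"
    using finitely_presented_quotient[OF distinct_chart_vars, of ?M d e \<alpha>] minors_chart_ring[OF sum e0, where ?'a = 'a]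
    by (simp add: T_phi_def chart_ring_def)
  moreover have "(\<lambda>c. ?I +>\<^bsub>?R\<^esub> Const c) \<in> Ring.ring_hom ring_of_type_algebra (?R Quot ?I)"
  proof -
    have "Const \<in> Ring.ring_hom ring_of_type_algebra ?R"
      using Const_hom by (auto simp: Ring.ring_hom_def chart_ring_def)
    from ring_hom_trans[OF this I.rcos_ring_hom] show ?thesis by (simp add: comp_def)
  qed
  ultimately show "smooth_algebra TYPE('c) (\<lambda>c. ?I +>\<^bsub>?R\<^esub> Const c) (?R Quot ?I)"
    unfolding smooth_algebra_def
    using I.quotient_is_cring[OF chart_ring_cring] formally_smooth_T_phi[OF sum e0 \<alpha>] by blast
qed

theorem corollary1p4:
  fixes d :: nat and e :: "nat \<Rightarrow> nat"
  assumes "d \<ge> 1" and "(\<Sum>r=1..d. r * e r) = d" and "e 0 = d"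
  shows "(\<forall>q \<in> subscheme_points d e
              (T_phi d e ::
                (nat \<Rightarrow> nat) \<Rightarrow> (nat \<times> nat, 'a::{alg_closed_field, field_char_0}) mpoly set).
            \<forall>\<alpha> \<in> chart_indices d e. q \<in> U_points d e \<alpha> \<longrightarrow>
              (\<exists>\<theta>. \<theta> \<noteq> 0 \<and> (\<exists>I J. submatrix (jacobian d e \<alpha> q) I J = \<theta> \<cdot>\<^sub>m 1\<^sub>m d))) \<and>
         smooth_subscheme TYPE('c) d e
           (T_phi d e ::
             (nat \<Rightarrow> nat) \<Rightarrow> (nat \<times> nat, 'a::{alg_closed_field, field_char_0}) mpoly set)"
proof (intro conjI ballI impI)
  show "smooth_subscheme TYPE('c) d e
    (T_phi d e :: (nat \<Rightarrow> nat) \<Rightarrow> (nat \<times> nat, 'a) mpoly set)"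
    by (rule smooth_T_phi[OF assms(2,3)])
next
  fix q :: "nat \<Rightarrow> nat \<Rightarrow> 'a" and \<alpha>
  assume q: "q \<in> subscheme_points d e (T_phi d e)"
    and \<alpha>: "\<alpha> \<in> chart_indices d e" "q \<in> U_points d e \<alpha>"
  have "\<alpha> 0 \<le> d"
    using \<alpha>(1) assms(3) by (auto simp: chart_indices_def)
  with theta_nonzero_at_point[OF assms(2,3) q \<alpha>] jacobian_submatrix[of e d \<alpha> q, OF assms(2,3)]
  show "\<exists>\<theta>. \<theta> \<noteq> 0 \<and> (\<exists>I J. submatrix (jacobian d e \<alpha> q) I J = \<theta> \<cdot>\<^sub>m 1\<^sub>m d)"
    by blast
qed

end
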